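(* Let $k$ be a commutative ring, $A$ a $k$-algebra, and $G$ a group. Then there is a bijective correspondence between partial $G$-actions and partial $kG$-actions on $A$.
   Context: Algebras are associative with unit, and $\otimes$ is over $k$. A partial action of $G$ on $A$ consists of a set of idempotents $\{e_\sigma\mid \sigma\in G\}\subset A$ (not assumed central) and a set of isomorphisms (of $k$-modules, not assumed to be multiplicative) $\alpha_\sigma: e_{\sigma^{-1}}A\to e_\sigma A$ ($\sigma\in G$) such that $e_1=1_A$, $\alpha_1={\rm id}_A$ and, for all $\sigma,\tau\in G$ and $a,b\in A$: (1) $e_\sigma\alpha_{\sigma\tau}(e_{\tau^{-1}\sigma^{-1}}a)=\alpha_\sigma(e_{\sigma^{-1}}\alpha_\tau(e_{\tau^{-1}}a))$; (2) $\alpha_\sigma(e_{\sigma^{-1}}ab)=\alpha_\sigma(e_{\sigma^{-1}}a)\alpha_\sigma(e_{\sigma^{-1}}b)$; (3) $\alpha_\sigma(e_{\sigma^{-1}})=e_\sigma$. For a $k$-bialgebra $H$ with comultiplication $h\mapsto h_{(1)}\otimes h_{(2)}$, a partial $H$-action on $A$ (making $A$ a left partial $H$-module algebra) is a $k$-linear map $\kappa:H\otimes A\to A$, $\kappa(h\otimes a)=h\cdot a$, such that for all $a,b\in A$, $h,g\in H$: $h\cdot(ab)=(h_{(1)}\cdot a)(h_{(2)}\cdot b)$; $h\cdot(a(g\cdot b))=(h_{(1)}\cdot a)((h_{(2)}g)\cdot b)$; $1_H\cdot a=a$. The group algebra $kG$ is a bialgebra in which every $\sigma\in G$ is grouplike.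 *)

theory Defs
  imports "HOL-Algebra.Module" "HOL-Algebra.AbelCoset"
begin

section \<open>Modules and algebras\<close>

text \<open>
  The locale \<^locale>\<open>algebra\<close> of HOL-Algebra only covers commutative algebras.  The carriers may be
  trivial.  Module records inherit the fields \<open>mult\<close> and \<open>one\<close> from rings; where only a module
  is meant, these are \<open>undefined\<close>.
\<close>

locale assoc_algebra = module R A + ring A for R (structure) and A (structure) +
  assumes smult_mult_left:
      "\<lbrakk>c \<in> carrier R; x \<in> carrier A; y \<in> carrier A\<rbrakk> \<Longrightarrow>
        (c \<odot>\<^bsub>A\<^esub> x) \<otimes>\<^bsub>A\<^esub> y = c \<odot>\<^bsub>A\<^esub> (x \<otimes>\<^bsub>A\<^esub> y)"
    and smult_mult_right:
      "\<lbrakk>c \<in> carrier R; x \<in> carrier A; y \<in> carrier A\<rbrakk> \<Longrightarrow>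
        x \<otimes>\<^bsub>A\<^esub> (c \<odot>\<^bsub>A\<^esub> y) = c \<odot>\<^bsub>A\<^esub> (x \<otimes>\<^bsub>A\<^esub> y)"

definition mod_hom ::
  "('k, 'r) ring_scheme \<Rightarrow> ('k, 'm, 's) module_scheme \<Rightarrow> ('k, 'n, 't) module_scheme \<Rightarrow> ('m \<Rightarrow> 'n) set"
  where "mod_hom k M N = {f. f \<in> carrier M \<rightarrow> carrier N \<and>
    (\<forall>x\<in>carrier M. \<forall>y\<in>carrier M. f (x \<oplus>\<^bsub>M\<^esub> y) = f x \<oplus>\<^bsub>N\<^esub> f y) \<and>
    (\<forall>c\<in>carrier k. \<forall>x\<in>carrier M. f (c \<odot>\<^bsub>M\<^esub> x) = c \<odot>\<^bsub>N\<^esub> f x)}"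

definition mod_iso ::
  "('k, 'r) ring_scheme \<Rightarrow> ('k, 'm, 's) module_scheme \<Rightarrow> ('k, 'n, 't) module_scheme \<Rightarrow> ('m \<Rightarrow> 'n) set"
  where "mod_iso k M N = {f \<in> mod_hom k M N. bij_betw f (carrier M) (carrier N)}"

definition ring_as_module :: "('k, 'r) ring_scheme \<Rightarrow> ('k, 'k) module"
  where "ring_as_module k = \<lparr>carrier = carrier k, mult = mult k, one = one k,
    zero = zero k, add = add k, smult = mult k\<rparr>"

definition quotient_module :: "('k, 'm, 's) module_scheme \<Rightarrow> 'm set \<Rightarrow> ('k, 'm set) module"
  where "quotient_module M N = \<lparr>carrier = a_rcosets\<^bsub>M\<^esub> N, mult = undefined, one = undefined,
    zero = N, add = set_add M, smult = (\<lambda>c X. \<Union>x\<in>X. N +>\<^bsub>M\<^esub> (c \<odot>\<^bsub>M\<^esub> x))\<rparr>"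


section \<open>Free modules\<close>

text \<open>The free module on \<open>X\<close> consists of the finitely supported functions vanishing outside \<open>X\<close>.\<close>

definition fsupp :: "('k, 'r) ring_scheme \<Rightarrow> ('x \<Rightarrow> 'k) \<Rightarrow> 'x set"
  where "fsupp k f = {x. f x \<noteq> \<zero>\<^bsub>k\<^esub>}"

definition free_module :: "('k, 'r) ring_scheme \<Rightarrow> 'x set \<Rightarrow> ('k, 'x \<Rightarrow> 'k) module"
  where "free_module k X = \<lparr>carrier = {f. range f \<subseteq> carrier k \<and> finite (fsupp k f) \<and> fsupp k f \<subseteq> X},
    mult = undefined, one = undefined, zero = (\<lambda>_. \<zero>\<^bsub>k\<^esub>),
    add = (\<lambda>f g x. f x \<oplus>\<^bsub>k\<^esub> g x), smult = (\<lambda>c f x. c \<otimes>\<^bsub>k\<^esub> f x)\<rparr>"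

definition basis_vec :: "('k, 'r) ring_scheme \<Rightarrow> 'x \<Rightarrow> 'x \<Rightarrow> 'k"
  where "basis_vec k x = (\<lambda>y. if y = x then \<one>\<^bsub>k\<^esub> else \<zero>\<^bsub>k\<^esub>)"

text \<open>The linear extension to a free module of a map \<open>\<phi>\<close> from the basis to the module \<open>P\<close>.\<close>

definition lin_ext ::
  "('k, 'r) ring_scheme \<Rightarrow> ('k, 'p, 's) module_scheme \<Rightarrow> ('x \<Rightarrow> 'p) \<Rightarrow> ('x \<Rightarrow> 'k) \<Rightarrow> 'p"
  where "lin_ext k P \<phi> f = (\<Oplus>\<^bsub>P\<^esub>x\<in>fsupp k f. f x \<odot>\<^bsub>P\<^esub> \<phi> x)"


section \<open>Tensor products\<close>

definition tensor_free ::
  "('k, 'r) ring_scheme \<Rightarrow> ('k, 'm, 's) module_scheme \<Rightarrow> ('k, 'n, 't) module_scheme \<Rightarrow>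
    ('k, 'm \<times> 'n \<Rightarrow> 'k) module"
  where "tensor_free k M N = free_module k (carrier M \<times> carrier N)"

definition tensor_gens ::
  "('k, 'r) ring_scheme \<Rightarrow> ('k, 'm, 's) module_scheme \<Rightarrow> ('k, 'n, 't) module_scheme \<Rightarrow>
    ('m \<times> 'n \<Rightarrow> 'k) set"
  where "tensor_gens k M N = (let F = tensor_free k M N; b = (\<lambda>x y. basis_vec k (x, y)) in
      {b (x \<oplus>\<^bsub>M\<^esub> x') y \<ominus>\<^bsub>F\<^esub> (b x y \<oplus>\<^bsub>F\<^esub> b x' y) | x x' y.
        x \<in> carrier M \<and> x' \<in> carrier M \<and> y \<in> carrier N}
    \<union> {b x (y \<oplus>\<^bsub>N\<^esub> y') \<ominus>\<^bsub>F\<^esub> (b x y \<oplus>\<^bsub>F\<^esub> b x y') | x y y'.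
        x \<in> carrier M \<and> y \<in> carrier N \<and> y' \<in> carrier N}
    \<union> {b (c \<odot>\<^bsub>M\<^esub> x) y \<ominus>\<^bsub>F\<^esub> c \<odot>\<^bsub>F\<^esub> b x y | c x y.
        c \<in> carrier k \<and> x \<in> carrier M \<and> y \<in> carrier N}
    \<union> {b x (c \<odot>\<^bsub>N\<^esub> y) \<ominus>\<^bsub>F\<^esub> c \<odot>\<^bsub>F\<^esub> b x y | c x y.
        c \<in> carrier k \<and> x \<in> carrier M \<and> y \<in> carrier N})"

definition tensor_rels ::
  "('k, 'r) ring_scheme \<Rightarrow> ('k, 'm, 's) module_scheme \<Rightarrow> ('k, 'n, 't) module_scheme \<Rightarrow>
    ('m \<times> 'n \<Rightarrow> 'k) set"
  where "tensor_rels k M N =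
    \<Inter>{S. submodule S k (tensor_free k M N) \<and> tensor_gens k M N \<subseteq> S}"

definition tensor_product ::
  "('k, 'r) ring_scheme \<Rightarrow> ('k, 'm, 's) module_scheme \<Rightarrow> ('k, 'n, 't) module_scheme \<Rightarrow>
    ('k, ('m \<times> 'n \<Rightarrow> 'k) set) module"
  where "tensor_product k M N = quotient_module (tensor_free k M N) (tensor_rels k M N)"

definition pure_tensor ::
  "('k, 'r) ring_scheme \<Rightarrow> ('k, 'm, 's) module_scheme \<Rightarrow> ('k, 'n, 't) module_scheme \<Rightarrow>
    'm \<Rightarrow> 'n \<Rightarrow> ('m \<times> 'n \<Rightarrow> 'k) set"
  where "pure_tensor k M N x y = tensor_rels k M N +>\<^bsub>tensor_free k M N\<^esub> basis_vec k (x, y)"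

text \<open>
  The linear map \<open>M \<otimes> N \<rightarrow> P\<close> induced by a bilinear map \<open>\<phi>\<close>, sending \<open>x \<otimes> y\<close> to \<open>\<phi> x y\<close>: by
  bilinearity, \<open>lin_ext\<close> is constant on each coset of \<open>tensor_rels\<close>.  It expresses Sweedler
  notation: the sum of the \<open>\<phi> h\<^sub>1 h\<^sub>2\<close> is \<open>tensor_lift k P \<phi> (\<Delta> h)\<close>.
\<close>

definition tensor_lift ::
  "('k, 'r) ring_scheme \<Rightarrow> ('k, 'p, 's) module_scheme \<Rightarrow> ('m \<Rightarrow> 'n \<Rightarrow> 'p) \<Rightarrow>
    ('m \<times> 'n \<Rightarrow> 'k) set \<Rightarrow> 'p"
  where "tensor_lift k P \<phi> t = the_elem (lin_ext k P (\<lambda>(x, y). \<phi> x y) ` t)"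


section \<open>Bialgebras\<close>

record ('k, 'h) bialgebra = "('k, 'h) module" +
  comult :: "'h \<Rightarrow> ('h \<times> 'h \<Rightarrow> 'k) set"
  counit :: "'h \<Rightarrow> 'k"

definition sweedler ::
  "('k, 'r) ring_scheme \<Rightarrow> ('k, 'h, 's) bialgebra_scheme \<Rightarrow> ('k, 'p, 't) module_scheme \<Rightarrow>
    ('h \<Rightarrow> 'h \<Rightarrow> 'p) \<Rightarrow> 'h \<Rightarrow> 'p"
  where "sweedler k H P \<phi> h = tensor_lift k P \<phi> (comult H h)"

text \<open>
  The last four axioms state that comultiplication and counit are algebra maps.
\<close>

locale bialgebra = assoc_algebra k H for k (structure) and H (structure) +
  assumes comult_hom: "comult H \<in> mod_hom k H (tensor_product k H H)"
    and counit_hom: "counit H \<in> mod_hom k H (ring_as_module k)"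
    and coassoc: "h \<in> carrier H \<Longrightarrow>
      sweedler k H (tensor_product k H (tensor_product k H H))
        (\<lambda>x y. sweedler k H (tensor_product k H (tensor_product k H H))
          (\<lambda>u v. pure_tensor k H (tensor_product k H H) u (pure_tensor k H H v y)) x) h =
      sweedler k H (tensor_product k H (tensor_product k H H))
        (\<lambda>x y. pure_tensor k H (tensor_product k H H) x (comult H y)) h"
    and counit_left: "h \<in> carrier H \<Longrightarrow> sweedler k H H (\<lambda>x y. counit H x \<odot>\<^bsub>H\<^esub> y) h = h"
    and counit_right: "h \<in> carrier H \<Longrightarrow> sweedler k H H (\<lambda>x y. counit H y \<odot>\<^bsub>H\<^esub> x) h = h"
    and comult_one: "comult H \<one>\<^bsub>H\<^esub> = pure_tensor k H H \<one>\<^bsub>H\<^esub> \<one>\<^bsub>H\<^esub>"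
    and comult_mult: "\<lbrakk>g \<in> carrier H; h \<in> carrier H\<rbrakk> \<Longrightarrow>
      comult H (g \<otimes>\<^bsub>H\<^esub> h) =
      sweedler k H (tensor_product k H H)
        (\<lambda>g1 g2. sweedler k H (tensor_product k H H)
          (\<lambda>h1 h2. pure_tensor k H H (g1 \<otimes>\<^bsub>H\<^esub> h1) (g2 \<otimes>\<^bsub>H\<^esub> h2)) h) g"
    and counit_one: "counit H \<one>\<^bsub>H\<^esub> = \<one>\<^bsub>k\<^esub>"
    and counit_mult: "\<lbrakk>g \<in> carrier H; h \<in> carrier H\<rbrakk> \<Longrightarrow>
      counit H (g \<otimes>\<^bsub>H\<^esub> h) = counit H g \<otimes>\<^bsub>k\<^esub> counit H h"

definition group_algebra ::
  "('k, 'r) ring_scheme \<Rightarrow> ('g, 's) monoid_scheme \<Rightarrow> ('k, 'g \<Rightarrow> 'k) bialgebra"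
  where "group_algebra k G = (let F = free_module k (carrier G) in
    \<lparr>carrier = carrier F,
     mult = (\<lambda>x y. lin_ext k F (\<lambda>\<sigma>. lin_ext k F (\<lambda>\<tau>. basis_vec k (\<sigma> \<otimes>\<^bsub>G\<^esub> \<tau>)) y) x),
     one = basis_vec k \<one>\<^bsub>G\<^esub>,
     zero = zero F,
     add = add F,
     smult = smult F,
     comult = lin_ext k (tensor_product k F F)
       (\<lambda>\<sigma>. pure_tensor k F F (basis_vec k \<sigma>) (basis_vec k \<sigma>)),
     counit = lin_ext k (ring_as_module k) (\<lambda>_. \<one>\<^bsub>k\<^esub>)\<rparr>)"


section \<open>Partial actions of bialgebras\<close>

locale partial_module_algebra =
  H: bialgebra k H + A: assoc_algebra k A for k (structure) and H (structure) and A (structure) +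
  fixes \<kappa> :: "('b \<times> 'c \<Rightarrow> 'a) set \<Rightarrow> 'c"
    and act :: "'b \<Rightarrow> 'c \<Rightarrow> 'c"
  defines "act h a \<equiv> \<kappa> (pure_tensor k H A h a)"
  assumes hom: "\<kappa> \<in> mod_hom k (tensor_product k H A) A"
    and act_mult: "\<lbrakk>h \<in> carrier H; a \<in> carrier A; b \<in> carrier A\<rbrakk> \<Longrightarrow>
      act h (a \<otimes>\<^bsub>A\<^esub> b) = sweedler k H A (\<lambda>h1 h2. act h1 a \<otimes>\<^bsub>A\<^esub> act h2 b) h"
    and act_mult_act: "\<lbrakk>h \<in> carrier H; g \<in> carrier H; a \<in> carrier A; b \<in> carrier A\<rbrakk> \<Longrightarrow>
      act h (a \<otimes>\<^bsub>A\<^esub> act g b) =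
      sweedler k H A (\<lambda>h1 h2. act h1 a \<otimes>\<^bsub>A\<^esub> act (h2 \<otimes>\<^bsub>H\<^esub> g) b) h"
    and act_one: "a \<in> carrier A \<Longrightarrow> act \<one>\<^bsub>H\<^esub> a = a"

text \<open>
  Maps are total in HOL, so sets of maps only count their elements correctly when the values
  outside the domain are fixed; hence the restrictions to extensional functions here and below.
\<close>

definition partial_bialgebra_actions ::
  "('k, 'r) ring_scheme \<Rightarrow> ('k, 'h, 's) bialgebra_scheme \<Rightarrow> ('k, 'a, 't) module_scheme \<Rightarrow>
    (('h \<times> 'a \<Rightarrow> 'k) set \<Rightarrow> 'a) set"
  where "partial_bialgebra_actions k H A =
    {\<kappa> \<in> extensional (carrier (tensor_product k H A)). partial_module_algebra k H A \<kappa>}"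


section \<open>Partial actions of groups\<close>

text \<open>Note that \<open>x <#\<^bsub>A\<^esub> carrier A\<close> is the right ideal generated by \<open>x\<close>.\<close>

abbreviation right_ideal_module :: "('k, 'a, 't) module_scheme \<Rightarrow> 'a \<Rightarrow> ('k, 'a, 't) module_scheme"
  where "right_ideal_module A x \<equiv> A\<lparr>carrier := x <#\<^bsub>A\<^esub> carrier A\<rparr>"

locale partial_group_action =
  group G + A: assoc_algebra k A for k (structure) and G (structure) and A (structure) +
  fixes e :: "'c \<Rightarrow> 'd" and \<alpha> :: "'c \<Rightarrow> 'd \<Rightarrow> 'd"
  assumes e_closed: "\<sigma> \<in> carrier G \<Longrightarrow> e \<sigma> \<in> carrier A"
    and e_idem: "\<sigma> \<in> carrier G \<Longrightarrow> e \<sigma> \<otimes>\<^bsub>A\<^esub> e \<sigma> = e \<sigma>"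
    and alpha_iso: "\<sigma> \<in> carrier G \<Longrightarrow>
      \<alpha> \<sigma> \<in> mod_iso k (right_ideal_module A (e (inv\<^bsub>G\<^esub> \<sigma>))) (right_ideal_module A (e \<sigma>))"
    and e_one: "e \<one>\<^bsub>G\<^esub> = \<one>\<^bsub>A\<^esub>"
    and alpha_one: "a \<in> carrier A \<Longrightarrow> \<alpha> \<one>\<^bsub>G\<^esub> a = a"
    and alpha_comp: "\<lbrakk>\<sigma> \<in> carrier G; \<tau> \<in> carrier G; a \<in> carrier A\<rbrakk> \<Longrightarrow>
      e \<sigma> \<otimes>\<^bsub>A\<^esub> \<alpha> (\<sigma> \<otimes>\<^bsub>G\<^esub> \<tau>) (e (inv\<^bsub>G\<^esub> \<tau> \<otimes>\<^bsub>G\<^esub> inv\<^bsub>G\<^esub> \<sigma>) \<otimes>\<^bsub>A\<^esub> a) =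
      \<alpha> \<sigma> (e (inv\<^bsub>G\<^esub> \<sigma>) \<otimes>\<^bsub>A\<^esub> \<alpha> \<tau> (e (inv\<^bsub>G\<^esub> \<tau>) \<otimes>\<^bsub>A\<^esub> a))"
    and alpha_mult: "\<lbrakk>\<sigma> \<in> carrier G; a \<in> carrier A; b \<in> carrier A\<rbrakk> \<Longrightarrow>
      \<alpha> \<sigma> (e (inv\<^bsub>G\<^esub> \<sigma>) \<otimes>\<^bsub>A\<^esub> a \<otimes>\<^bsub>A\<^esub> b) =
      \<alpha> \<sigma> (e (inv\<^bsub>G\<^esub> \<sigma>) \<otimes>\<^bsub>A\<^esub> a) \<otimes>\<^bsub>A\<^esub> \<alpha> \<sigma> (e (inv\<^bsub>G\<^esub> \<sigma>) \<otimes>\<^bsub>A\<^esub> b)"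
    and alpha_e: "\<sigma> \<in> carrier G \<Longrightarrow> \<alpha> \<sigma> (e (inv\<^bsub>G\<^esub> \<sigma>)) = e \<sigma>"

definition partial_group_actions ::
  "('k, 'r) ring_scheme \<Rightarrow> ('g, 's) monoid_scheme \<Rightarrow> ('k, 'a, 't) module_scheme \<Rightarrow>
    (('g \<Rightarrow> 'a) \<times> ('g \<Rightarrow> 'a \<Rightarrow> 'a)) set"
  where "partial_group_actions k G A = {(e, \<alpha>).
    e \<in> extensional (carrier G) \<and> \<alpha> \<in> extensional (carrier G) \<and>
    (\<forall>\<sigma>\<in>carrier G. \<alpha> \<sigma> \<in> extensional (e (inv\<^bsub>G\<^esub> \<sigma>) <#\<^bsub>A\<^esub> carrier A)) \<and>
    partial_group_action k G A e \<alpha>}"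

end

theory Submission
  imports Defs
begin

text \<open>
  A partial \<open>kG\<close>-action is determined by the maps \<open>\<theta> \<sigma> = (\<sigma> \<cdot> _)\<close>, as the elements of \<open>G\<close> form a basis of
  \<open>kG\<close>; since they are grouplike, its axioms become
  \<open>\<theta> \<sigma> (a b) = \<theta> \<sigma> a \<theta> \<sigma> b\<close> and \<open>\<theta> \<sigma> (a \<theta> \<tau> b) = \<theta> \<sigma> a \<theta> (\<sigma> \<tau>) b\<close>.
  A partial \<open>G\<close>-action gives such maps by \<open>\<theta> \<sigma> a = \<alpha> \<sigma> (e (inv \<sigma>) a)\<close>, the second identity following
  from \<open>\<theta> \<sigma> a = \<theta> \<sigma> a e \<sigma>\<close>.  Conversely, put \<open>e \<sigma> = \<theta> \<sigma> 1\<close>.  Then \<open>e \<sigma>\<close> fixes the image of \<open>\<theta> \<sigma>\<close>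
  from the left and \<open>\<theta> \<sigma> (\<theta> (inv \<sigma>) a) = e \<sigma> a\<close>, so \<open>\<theta> \<sigma>\<close> and \<open>\<theta> (inv \<sigma>)\<close> restrict to mutually inverse
  bijections between \<open>e (inv \<sigma>) A\<close> and \<open>e \<sigma> A\<close>.
\<close>


section \<open>Linear and bilinear maps\<close>

lemma mod_homI:
  assumes "\<And>x. x \<in> carrier M \<Longrightarrow> f x \<in> carrier N"
    and "\<And>x y. \<lbrakk>x \<in> carrier M; y \<in> carrier M\<rbrakk> \<Longrightarrow> f (x \<oplus>\<^bsub>M\<^esub> y) = f x \<oplus>\<^bsub>N\<^esub> f y"
    and "\<And>c x. \<lbrakk>c \<in> carrier k; x \<in> carrier M\<rbrakk> \<Longrightarrow> f (c \<odot>\<^bsub>M\<^esub> x) = c \<odot>\<^bsub>N\<^esub> f x"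
  shows "f \<in> mod_hom k M N"
  using assms by (auto simp: mod_hom_def)

lemma mod_homD:
  assumes "f \<in> mod_hom k M N"
  shows "x \<in> carrier M \<Longrightarrow> f x \<in> carrier N"
    and "\<lbrakk>x \<in> carrier M; y \<in> carrier M\<rbrakk> \<Longrightarrow> f (x \<oplus>\<^bsub>M\<^esub> y) = f x \<oplus>\<^bsub>N\<^esub> f y"
    and "\<lbrakk>c \<in> carrier k; x \<in> carrier M\<rbrakk> \<Longrightarrow> f (c \<odot>\<^bsub>M\<^esub> x) = c \<odot>\<^bsub>N\<^esub> f x"
  using assms by (auto simp: mod_hom_def)

lemma mod_hom_zero:
  assumes "module k M" "module k N" "f \<in> mod_hom k M N"
  shows "f \<zero>\<^bsub>M\<^esub> = \<zero>\<^bsub>N\<^esub>"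
proof -
  interpret M: module k M by fact
  interpret N: module k N by fact
  have "f (\<zero>\<^bsub>k\<^esub> \<odot>\<^bsub>M\<^esub> \<zero>\<^bsub>M\<^esub>) = \<zero>\<^bsub>k\<^esub> \<odot>\<^bsub>N\<^esub> f \<zero>\<^bsub>M\<^esub>"
    by (rule mod_homD[OF assms(3)]) auto
  then show ?thesis using mod_homD(1)[OF assms(3)] by simp
qed

lemma mod_hom_minus:
  assumes "module k M" "module k N" "f \<in> mod_hom k M N" "x \<in> carrier M" "y \<in> carrier M"
  shows "f (x \<ominus>\<^bsub>M\<^esub> y) = f x \<ominus>\<^bsub>N\<^esub> f y"
proof -
  interpret M: module k M by fact
  interpret N: module k N by fact
  have "f (\<ominus>\<^bsub>M\<^esub> y) = f ((\<ominus>\<^bsub>k\<^esub> \<one>\<^bsub>k\<^esub>) \<odot>\<^bsub>M\<^esub> y)"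
    using assms(5) by (simp add: M.smult_l_minus)
  also have "\<dots> = \<ominus>\<^bsub>N\<^esub> f y"
    using assms(5) by (simp add: mod_homD[OF assms(3)] N.smult_l_minus)
  finally show ?thesis
    using assms(4,5) by (simp add: M.minus_eq N.minus_eq mod_homD[OF assms(3)])
qed

lemma mod_hom_compose:
  assumes "f \<in> mod_hom k M N" "g \<in> mod_hom k N P"
  shows "(\<lambda>x. g (f x)) \<in> mod_hom k M P"
  using assms by (auto simp: mod_hom_def Pi_def)

lemma mod_hom_id: "(\<lambda>x. x) \<in> mod_hom k M M"
  by (auto simp: mod_hom_def)

lemma mod_hom_add:
  assumes "module k P" "f \<in> mod_hom k M P" "g \<in> mod_hom k M P"
  shows "(\<lambda>x. f x \<oplus>\<^bsub>P\<^esub> g x) \<in> mod_hom k M P"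
proof -
  interpret P: module k P by fact
  show ?thesis
    using mod_homD[OF assms(2)] mod_homD[OF assms(3)]
    by (intro mod_homI) (auto simp: P.smult_r_distr P.a_ac)
qed

lemma mod_hom_smult:
  assumes "module k P" "c \<in> carrier k" "f \<in> mod_hom k M P"
  shows "(\<lambda>x. c \<odot>\<^bsub>P\<^esub> f x) \<in> mod_hom k M P"
proof -
  interpret P: module k P by fact
  show ?thesis
    using mod_homD[OF assms(3)] assms(2)
    by (intro mod_homI) (auto simp: P.smult_r_distr P.smult_assoc1[symmetric] P.R.m_comm)
qed

text \<open>Linearity concerns only values on the carrier, which is closed under the operations. So
  a linear map may be made extensional, or be replaced by another formula valid on the
  carrier.\<close>

lemma mod_hom_cong:
  assumes "module k M" "f \<in> mod_hom k M N" "\<And>x. x \<in> carrier M \<Longrightarrow> f x = g x"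
  shows "g \<in> mod_hom k M N"
proof -
  interpret M: module k M by fact
  show ?thesis
  proof (rule mod_homI)
    fix x assume x: "x \<in> carrier M"
    show "g x \<in> carrier N" using mod_homD[OF assms(2)] assms(3) x by metis
    fix y assume y: "y \<in> carrier M"
    show "g (x \<oplus>\<^bsub>M\<^esub> y) = g x \<oplus>\<^bsub>N\<^esub> g y"
      using mod_homD[OF assms(2)] assms(3) x y M.add.m_closed by metis
  next
    fix c x assume c: "c \<in> carrier k" and x: "x \<in> carrier M"
    show "g (c \<odot>\<^bsub>M\<^esub> x) = c \<odot>\<^bsub>N\<^esub> g x"
      using mod_homD[OF assms(2)] assms(3) x c M.smult_closed by metis
  qed
qed

text \<open>The relations of a tensor product form the smallest submodule containing the generators;
  a linear map that kills the generators therefore kills all relations, its kernel being a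
  submodule.\<close>

lemma mod_hom_kernel_submodule:
  assumes "module k M" "module k N" "f \<in> mod_hom k M N"
  shows "submodule {x \<in> carrier M. f x = \<zero>\<^bsub>N\<^esub>} k M"
proof -
  interpret M: module k M by fact
  interpret N: module k N by fact
  have "f (\<ominus>\<^bsub>M\<^esub> x) = \<zero>\<^bsub>N\<^esub>" if "x \<in> carrier M" "f x = \<zero>\<^bsub>N\<^esub>" for x
    using mod_hom_minus[OF assms M.zero_closed that(1)] that mod_hom_zero[OF assms]
    by (simp add: M.minus_eq N.minus_eq)
  then show ?thesis
    by (intro M.submoduleI) (auto simp: mod_homD[OF assms(3)] mod_hom_zero[OF assms])
qed

text \<open>Curried, and phrased through \<open>mod_hom\<close> in each argument separately, so that
  fixing either argument gives a linear map to which the facts above apply directly.\<close>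

definition bilin ::
  "('k, 'r) ring_scheme \<Rightarrow> ('k, 'm, 's) module_scheme \<Rightarrow> ('k, 'n, 't) module_scheme \<Rightarrow>
    ('k, 'p, 'u) module_scheme \<Rightarrow> ('m \<Rightarrow> 'n \<Rightarrow> 'p) set"
  where "bilin k M N P = {\<phi>. (\<forall>x\<in>carrier M. \<phi> x \<in> mod_hom k N P) \<and>
    (\<forall>y\<in>carrier N. (\<lambda>x. \<phi> x y) \<in> mod_hom k M P)}"

lemma bilinI:
  assumes "\<And>x. x \<in> carrier M \<Longrightarrow> \<phi> x \<in> mod_hom k N P"
    and "\<And>y. y \<in> carrier N \<Longrightarrow> (\<lambda>x. \<phi> x y) \<in> mod_hom k M P"
  shows "\<phi> \<in> bilin k M N P"
  using assms by (auto simp: bilin_def)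

lemma bilin_left: "\<phi> \<in> bilin k M N P \<Longrightarrow> y \<in> carrier N \<Longrightarrow> (\<lambda>x. \<phi> x y) \<in> mod_hom k M P"
  and bilin_right: "\<phi> \<in> bilin k M N P \<Longrightarrow> x \<in> carrier M \<Longrightarrow> \<phi> x \<in> mod_hom k N P"
  by (auto simp: bilin_def)

lemma bilin_closed:
  "\<phi> \<in> bilin k M N P \<Longrightarrow> x \<in> carrier M \<Longrightarrow> y \<in> carrier N \<Longrightarrow> \<phi> x y \<in> carrier P"
  by (meson bilin_right mod_homD(1))

lemma bilin_compose:
  assumes "f \<in> mod_hom k M M'" "g \<in> mod_hom k N N'" "\<phi> \<in> bilin k M' N' P"
  shows "(\<lambda>x y. \<phi> (f x) (g y)) \<in> bilin k M N P"
proof (rule bilinI)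
  show "(\<lambda>y. \<phi> (f x) (g y)) \<in> mod_hom k N P" if "x \<in> carrier M" for x
    by (rule mod_hom_compose[OF assms(2)], rule bilin_right[OF assms(3)])
      (rule mod_homD(1)[OF assms(1) that])
  show "(\<lambda>x. \<phi> (f x) (g y)) \<in> mod_hom k M P" if "y \<in> carrier N" for y
    by (rule mod_hom_compose[OF assms(1)], rule bilin_left[OF assms(3)])
      (rule mod_homD(1)[OF assms(2) that])
qed

lemma mod_hom_bilin:
  assumes "\<phi> \<in> bilin k M N P" "f \<in> mod_hom k P Q"
  shows "(\<lambda>x y. f (\<phi> x y)) \<in> bilin k M N Q"
  by (intro bilinI mod_hom_compose[OF _ assms(2)] bilin_left[OF assms(1)] bilin_right[OF assms(1)])

text \<open>Both argument orders are recorded because the two counit axioms apply the counit to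
  different tensor factors.\<close>

lemma smult_bilin:
  assumes "module k P" "f \<in> mod_hom k M (ring_as_module k)" "g \<in> mod_hom k N P"
  shows "(\<lambda>x y. f x \<odot>\<^bsub>P\<^esub> g y) \<in> bilin k M N P"
    and "(\<lambda>y x. f x \<odot>\<^bsub>P\<^esub> g y) \<in> bilin k N M P"
proof -
  interpret P: module k P by fact
  note [simp] = mod_homD[OF assms(2), unfolded ring_as_module_def, simplified] mod_homD[OF assms(3)]
  have *: "(\<lambda>y. f x \<odot>\<^bsub>P\<^esub> g y) \<in> mod_hom k N P" if "x \<in> carrier M" for x
    using that by (intro mod_hom_smult assms) auto
  have **: "(\<lambda>x. f x \<odot>\<^bsub>P\<^esub> g y) \<in> mod_hom k M P" if "y \<in> carrier N" for y
    using that by (intro mod_homI) (auto simp: P.smult_l_distr P.smult_assoc1)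
  show "(\<lambda>x y. f x \<odot>\<^bsub>P\<^esub> g y) \<in> bilin k M N P" "(\<lambda>y x. f x \<odot>\<^bsub>P\<^esub> g y) \<in> bilin k N M P"
    using * ** by (auto intro: bilinI)
qed


section \<open>Free modules\<close>

lemma free_module_simps [simp]:
  "zero (free_module k X) = (\<lambda>_. \<zero>\<^bsub>k\<^esub>)"
  "add (free_module k X) = (\<lambda>f g x. f x \<oplus>\<^bsub>k\<^esub> g x)"
  "smult (free_module k X) = (\<lambda>c f x. c \<otimes>\<^bsub>k\<^esub> f x)"
  by (auto simp: free_module_def)

lemma free_module_carrier:
  "f \<in> carrier (free_module k X) \<longleftrightarrow>
    (\<forall>x. f x \<in> carrier k) \<and> finite (fsupp k f) \<and> fsupp k f \<subseteq> X"
  by (auto simp: free_module_def)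

lemma free_module_memI:
  assumes "\<And>x. f x \<in> carrier k" "finite S" "S \<subseteq> X" "\<And>x. x \<notin> S \<Longrightarrow> f x = \<zero>\<^bsub>k\<^esub>"
  shows "f \<in> carrier (free_module k X)"
proof -
  have "fsupp k f \<subseteq> S" using assms(4) by (auto simp: fsupp_def)
  then show ?thesis using assms(1-3) finite_subset by (fastforce simp: free_module_carrier)
qed

lemma free_module_module:
  assumes "cring k"
  shows "module k (free_module k X)"
proof -
  interpret k: cring k by fact
  let ?F = "free_module k X"
  have add: "(\<lambda>x. f x \<oplus>\<^bsub>k\<^esub> g x) \<in> carrier ?F" if "f \<in> carrier ?F" "g \<in> carrier ?F" for f g
    using that
    by (intro free_module_memI[of _ _ "fsupp k f \<union> fsupp k g"])
      (auto simp: free_module_carrier fsupp_def)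
  have smult: "(\<lambda>x. c \<otimes>\<^bsub>k\<^esub> f x) \<in> carrier ?F" if "c \<in> carrier k" "f \<in> carrier ?F" for c f
    using that
    by (intro free_module_memI[of _ _ "fsupp k f"]) (auto simp: free_module_carrier fsupp_def)
  have zero: "(\<lambda>_. \<zero>\<^bsub>k\<^esub>) \<in> carrier ?F"
    by (intro free_module_memI[of _ _ "{}"]) auto
  \<comment> \<open>The negative is taken as the multiple by minus one, so that its finite support
    comes from \<open>smult\<close>.\<close>
  have inv: "\<exists>g\<in>carrier ?F. (\<lambda>x. g x \<oplus>\<^bsub>k\<^esub> f x) = (\<lambda>_. \<zero>\<^bsub>k\<^esub>)" if "f \<in> carrier ?F" for f
    using that
    by (intro bexI[of _ "\<lambda>x. (\<ominus>\<^bsub>k\<^esub> \<one>\<^bsub>k\<^esub>) \<otimes>\<^bsub>k\<^esub> f x"] smult)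
      (auto simp: free_module_carrier k.l_minus k.l_neg)
  show ?thesis
  proof (intro moduleI abelian_groupI)
    show "cring k" by fact
  qed (use add smult zero inv in \<open>auto simp: fun_eq_iff free_module_carrier k.a_ac k.m_ac
      k.l_distr k.r_distr\<close>)
qed

lemma basis_vec_closed:
  assumes "cring k" "x \<in> X"
  shows "basis_vec k x \<in> carrier (free_module k X)"
proof -
  interpret k: cring k by fact
  show ?thesis
    using assms(2) by (intro free_module_memI[of _ _ "{x}"]) (auto simp: basis_vec_def)
qed

text \<open>Induction on a finite set \<open>S\<close> outside which \<open>f\<close> vanishes:
  resetting \<open>f x\<close> to zero splits off the term at \<open>x\<close>. Since
  \<open>S\<close> may exceed the support, the coefficient \<open>f x\<close> is allowed to be
  zero.\<close>

lemma free_module_induct [consumes 2, case_names zero step]: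
  assumes "cring k" "f \<in> carrier (free_module k X)"
    and zero: "P \<zero>\<^bsub>free_module k X\<^esub>"
    and step: "\<And>c x g. \<lbrakk>c \<in> carrier k; x \<in> X; g \<in> carrier (free_module k X); P g\<rbrakk> \<Longrightarrow>
      P (c \<odot>\<^bsub>free_module k X\<^esub> basis_vec k x \<oplus>\<^bsub>free_module k X\<^esub> g)"
  shows "P f"
proof -
  interpret k: cring k by fact
  have "P f" if "finite S" "S \<subseteq> X" "\<And>x. f x \<in> carrier k" "\<And>x. x \<notin> S \<Longrightarrow> f x = \<zero>\<^bsub>k\<^esub>" for S f
    using that
  proof (induction S arbitrary: f)
    case empty
    then have "f = \<zero>\<^bsub>free_module k X\<^esub>" by auto
    then show ?case using zero by simp
  next
    case (insert x S)
    let ?g = "f(x := \<zero>\<^bsub>k\<^esub>)"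
    have "P ?g" using insert.prems by (intro insert.IH) auto
    moreover have "?g \<in> carrier (free_module k X)"
      using insert by (intro free_module_memI[of _ _ S]) auto
    moreover have "f = f x \<odot>\<^bsub>free_module k X\<^esub> basis_vec k x \<oplus>\<^bsub>free_module k X\<^esub> ?g"
      using insert.prems by (auto simp: basis_vec_def fun_eq_iff)
    ultimately show ?case using step[of "f x" x ?g] insert.prems by auto
  qed
  moreover have "f x = \<zero>\<^bsub>k\<^esub>" if "x \<notin> fsupp k f" for x using that by (simp add: fsupp_def)
  ultimately show ?thesis using assms(2) unfolding free_module_carrier by blast
qed

text \<open>Agreement on the basis propagates along \<open>free_module_induct\<close>. The later
  reductions to basis vectors and to group elements rest on this.\<close>

lemma free_module_hom_eq:
  assumes "module k P" "f \<in> mod_hom k (free_module k X) P" "g \<in> mod_hom k (free_module k X) P"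
    and "\<And>x. x \<in> X \<Longrightarrow> f (basis_vec k x) = g (basis_vec k x)"
    and "h \<in> carrier (free_module k X)"
  shows "f h = g h"
proof -
  interpret P: module k P by fact
  have k: "cring k" ..
  interpret F: module k "free_module k X" by (rule free_module_module[OF k])
  show ?thesis using k assms(5)
  proof (induction rule: free_module_induct)
    case zero
    then show ?case
      using mod_hom_zero[OF F.module_axioms assms(1,2)] mod_hom_zero[OF F.module_axioms assms(1,3)]
      by simp
  next
    case (step c x h)
    have "basis_vec k x \<in> carrier (free_module k X)" using step by (intro basis_vec_closed k)
    with step F.smult_closed[of c "basis_vec k x"] assms(4)[of x] show ?case
      by (simp add: mod_homD[OF assms(2)] mod_homD[OF assms(3)] del: free_module_simps)
  qed
qed

text \<open>Two applications of the linear case: first in the second variable, with a basis vector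
  in the first, and then in the first variable with \<open>h\<close> fixed.\<close>

lemma free_module_bilin_eq:
  assumes "module k P" "\<phi> \<in> bilin k (free_module k X) (free_module k Y) P"
    and "\<psi> \<in> bilin k (free_module k X) (free_module k Y) P"
    and "\<And>x y. \<lbrakk>x \<in> X; y \<in> Y\<rbrakk> \<Longrightarrow> \<phi> (basis_vec k x) (basis_vec k y) = \<psi> (basis_vec k x) (basis_vec k y)"
    and "g \<in> carrier (free_module k X)" "h \<in> carrier (free_module k Y)"
  shows "\<phi> g h = \<psi> g h"
proof -
  interpret P: module k P by fact
  have k: "cring k" ..
  have "\<phi> (basis_vec k x) h = \<psi> (basis_vec k x) h" if "x \<in> X" for x
    by (rule free_module_hom_eq[OF assms(1) bilin_right[OF assms(2)] bilin_right[OF assms(3)] _ assms(6)])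
      (use that assms(4) basis_vec_closed[OF k] in auto)
  then show ?thesis
    by (intro free_module_hom_eq[OF assms(1) bilin_left[OF assms(2) assms(6)]
      bilin_left[OF assms(3) assms(6)] _ assms(5)])
qed

section \<open>Linear extension of maps from a basis\<close>

lemma lin_ext_superset:
  assumes "module k P" "f \<in> carrier (free_module k X)" "\<phi> \<in> X \<rightarrow> carrier P"
    and "finite S" "fsupp k f \<subseteq> S" "S \<subseteq> X"
  shows "lin_ext k P \<phi> f = (\<Oplus>\<^bsub>P\<^esub>x\<in>S. f x \<odot>\<^bsub>P\<^esub> \<phi> x)"
proof -
  interpret P: module k P by fact
  have "f x \<in> carrier k" for x using assms(2) by (simp add: free_module_carrier)
  moreover have "\<phi> x \<in> carrier P" if "x \<in> S" for x using that assms(3,6) by auto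
  ultimately show ?thesis unfolding lin_ext_def
    using assms(4,5) by (intro P.add.finprod_mono_neutral_cong_left) (auto simp: fsupp_def)
qed

lemma lin_ext_hom:
  assumes "module k P" "\<phi> \<in> X \<rightarrow> carrier P"
  shows "lin_ext k P \<phi> \<in> mod_hom k (free_module k X) P"
proof -
  interpret P: module k P by fact
  have k: "cring k" ..
  let ?F = "free_module k X"
  interpret F: module k ?F by (rule free_module_module[OF k])
  note eq = lin_ext_superset[OF assms(1) _ assms(2)]
  have Pi: "(\<lambda>x. f x \<odot>\<^bsub>P\<^esub> \<phi> x) \<in> S \<rightarrow> carrier P" if "f \<in> carrier ?F" "S \<subseteq> X" for f S
    using that assms(2) by (auto simp: free_module_carrier)
  show ?thesis
  proof (rule mod_homI)
    fix f assume f: "f \<in> carrier ?F"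
    show "lin_ext k P \<phi> f \<in> carrier P" unfolding lin_ext_def
      using f by (intro P.finsum_closed Pi) (auto simp: free_module_carrier)
  next
    fix f g assume fg: "f \<in> carrier ?F" "g \<in> carrier ?F"
    \<comment> \<open>The three sums run over different supports, and cancellation may shrink that
      of the sum. Padding with zero terms brings all of them to the common index set
      \<open>?S\<close>.\<close>
    let ?S = "fsupp k f \<union> fsupp k g"
    have S: "finite ?S" "?S \<subseteq> X" using fg by (auto simp: free_module_carrier)
    have sub: "fsupp k (f \<oplus>\<^bsub>?F\<^esub> g) \<subseteq> ?S" by (auto simp: fsupp_def)
    have "lin_ext k P \<phi> (f \<oplus>\<^bsub>?F\<^esub> g) = (\<Oplus>\<^bsub>P\<^esub>x\<in>?S. (f \<oplus>\<^bsub>?F\<^esub> g) x \<odot>\<^bsub>P\<^esub> \<phi> x)"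
      using F.add.m_closed fg S sub by (intro eq) auto
    also have "\<dots> = (\<Oplus>\<^bsub>P\<^esub>x\<in>?S. f x \<odot>\<^bsub>P\<^esub> \<phi> x \<oplus>\<^bsub>P\<^esub> g x \<odot>\<^bsub>P\<^esub> \<phi> x)"
      using fg S assms(2)
      by (intro P.finsum_cong') (auto simp: free_module_carrier P.smult_l_distr Pi_def subset_iff)
    also have "\<dots> = (\<Oplus>\<^bsub>P\<^esub>x\<in>?S. f x \<odot>\<^bsub>P\<^esub> \<phi> x) \<oplus>\<^bsub>P\<^esub> (\<Oplus>\<^bsub>P\<^esub>x\<in>?S. g x \<odot>\<^bsub>P\<^esub> \<phi> x)"
      using fg S by (intro P.finsum_addf Pi) auto
    also have "\<dots> = lin_ext k P \<phi> f \<oplus>\<^bsub>P\<^esub> lin_ext k P \<phi> g"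
      using fg S by (simp add: eq[of f ?S] eq[of g ?S])
    finally show "lin_ext k P \<phi> (f \<oplus>\<^bsub>?F\<^esub> g) = lin_ext k P \<phi> f \<oplus>\<^bsub>P\<^esub> lin_ext k P \<phi> g" .
  next
    fix c f assume c: "c \<in> carrier k" and f: "f \<in> carrier ?F"
    let ?S = "fsupp k f"
    have S: "finite ?S" "?S \<subseteq> X" using f by (auto simp: free_module_carrier)
    have sub: "fsupp k (c \<odot>\<^bsub>?F\<^esub> f) \<subseteq> ?S" using c by (auto simp: fsupp_def)
    have "lin_ext k P \<phi> (c \<odot>\<^bsub>?F\<^esub> f) = (\<Oplus>\<^bsub>P\<^esub>x\<in>?S. (c \<odot>\<^bsub>?F\<^esub> f) x \<odot>\<^bsub>P\<^esub> \<phi> x)"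
      using F.smult_closed[OF c f] S sub by (intro eq) auto
    also have "\<dots> = (\<Oplus>\<^bsub>P\<^esub>x\<in>?S. c \<odot>\<^bsub>P\<^esub> (f x \<odot>\<^bsub>P\<^esub> \<phi> x))"
      using c f S assms(2)
      by (intro P.finsum_cong') (auto simp: free_module_carrier P.smult_assoc1 Pi_def subset_iff)
    also have "\<dots> = c \<odot>\<^bsub>P\<^esub> lin_ext k P \<phi> f"
      unfolding lin_ext_def using c f S by (intro P.finsum_smult_ldistr[symmetric] Pi) auto
    finally show "lin_ext k P \<phi> (c \<odot>\<^bsub>?F\<^esub> f) = c \<odot>\<^bsub>P\<^esub> lin_ext k P \<phi> f" .
  qed
qed

lemma lin_ext_basis_vec:
  assumes "module k P" "\<phi> x \<in> carrier P"
  shows "lin_ext k P \<phi> (basis_vec k x) = \<phi> x"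
proof -
  interpret P: module k P by fact
  have k: "cring k" ..
  \<comment> \<open>The sum is taken over \<open>{x}\<close> and not over the support, which is
    empty if one equals zero in \<open>k\<close>.\<close>
  have "lin_ext k P \<phi> (basis_vec k x) = (\<Oplus>\<^bsub>P\<^esub>y\<in>{x}. basis_vec k x y \<odot>\<^bsub>P\<^esub> \<phi> y)"
    using assms(2) by (intro lin_ext_superset[OF assms(1) basis_vec_closed[OF k, of x "{x}"]])
      (auto simp: fsupp_def basis_vec_def)
  also have "\<dots> = \<phi> x"
    using assms(2) by (subst P.finsum_insert) (auto simp: basis_vec_def P.finsum_empty)
  finally show ?thesis .
qed

text \<open>Each linearity identity in the parameter compares two linear functions of
  \<open>f\<close>; on basis vectors it is the assumed linearity of \<open>\<phi>\<close> in the
  parameter.\<close>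

lemma lin_ext_param:
  assumes "module k P" "\<And>x. x \<in> X \<Longrightarrow> (\<lambda>m. \<phi> m x) \<in> mod_hom k M P"
    and "module k M" "f \<in> carrier (free_module k X)"
  shows "(\<lambda>m. lin_ext k P (\<phi> m) f) \<in> mod_hom k M P"
proof -
  interpret P: module k P by fact
  interpret M: module k M by fact
  note D = mod_homD[OF assms(2)]
  note hom = lin_ext_hom[OF assms(1)]
  have \<phi>: "\<phi> m \<in> X \<rightarrow> carrier P" if "m \<in> carrier M" for m using D(1) that by auto
  note basis = lin_ext_basis_vec[OF assms(1)]
  show ?thesis
  proof (rule mod_homI)
    fix m assume m: "m \<in> carrier M"
    show "lin_ext k P (\<phi> m) f \<in> carrier P" by (rule mod_homD(1)[OF hom[OF \<phi>[OF m]] assms(4)])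
    fix n assume n: "n \<in> carrier M"
    show "lin_ext k P (\<phi> (m \<oplus>\<^bsub>M\<^esub> n)) f = lin_ext k P (\<phi> m) f \<oplus>\<^bsub>P\<^esub> lin_ext k P (\<phi> n) f"
      by (rule free_module_hom_eq[OF assms(1) hom mod_hom_add[OF assms(1) hom hom] _ assms(4)])
        (use m n D \<phi> in \<open>auto simp: basis\<close>)
  next
    fix c m assume c: "c \<in> carrier k" and m: "m \<in> carrier M"
    show "lin_ext k P (\<phi> (c \<odot>\<^bsub>M\<^esub> m)) f = c \<odot>\<^bsub>P\<^esub> lin_ext k P (\<phi> m) f"
      by (rule free_module_hom_eq[OF assms(1) hom mod_hom_smult[OF assms(1) c hom] _ assms(4)])
        (use m c D \<phi> in \<open>auto simp: basis\<close>)
  qed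
qed

lemma lin_ext_bilin:
  assumes "module k P" "\<And>x. x \<in> X \<Longrightarrow> \<phi> x \<in> mod_hom k M P" "module k M"
  shows "(\<lambda>f m. lin_ext k P (\<lambda>x. \<phi> x m) f) \<in> bilin k (free_module k X) M P"
proof (rule bilinI)
  show "(\<lambda>m. lin_ext k P (\<lambda>x. \<phi> x m) f) \<in> mod_hom k M P" if "f \<in> carrier (free_module k X)" for f
    by (rule lin_ext_param[OF assms(1) assms(2) assms(3) that])
  show "lin_ext k P (\<lambda>x. \<phi> x m) \<in> mod_hom k (free_module k X) P" if "m \<in> carrier M" for m
    using mod_homD(1)[OF assms(2)] that by (intro lin_ext_hom[OF assms(1)]) auto
qed


section \<open>Quotients and tensor products\<close>

text \<open>\<open>Q\<close> enters as a mere record of operations: since \<open>p\<close> is onto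
  and respects them, each module axiom for \<open>Q\<close> is the image of that axiom for
  \<open>M\<close>. This serves quotients as well as records that share their module
  operations.\<close>

lemma module_image:
  assumes "module k M" "p \<in> mod_hom k M Q" "p ` carrier M = carrier Q" "p \<zero>\<^bsub>M\<^esub> = \<zero>\<^bsub>Q\<^esub>"
  shows "module k Q"
proof -
  interpret M: module k M by fact
  note p = mod_homD(2,3)[OF assms(2), symmetric] assms(4)[symmetric]
  have ex: "\<exists>x\<in>carrier M. u = p x" if "u \<in> carrier Q" for u using that assms(3) by auto
  have p_closed: "p x \<in> carrier Q" if "x \<in> carrier M" for x using that assms(3) by auto
  show ?thesis
  proof (intro moduleI abelian_groupI)
    show "cring k" ..
    show "\<zero>\<^bsub>Q\<^esub> \<in> carrier Q" using p_closed p(3) by simp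
    fix u assume "u \<in> carrier Q"
    then obtain x where x: "x \<in> carrier M" "u = p x" using ex by blast
    show "\<zero>\<^bsub>Q\<^esub> \<oplus>\<^bsub>Q\<^esub> u = u" using x by (simp add: p)
    show "\<exists>y\<in>carrier Q. y \<oplus>\<^bsub>Q\<^esub> u = \<zero>\<^bsub>Q\<^esub>"
      using x by (intro bexI[of _ "p (\<ominus>\<^bsub>M\<^esub> x)"]) (auto simp: p p_closed M.l_neg)
    show "\<one>\<^bsub>k\<^esub> \<odot>\<^bsub>Q\<^esub> u = u" using x by (simp add: p)
    show "c \<odot>\<^bsub>Q\<^esub> u \<in> carrier Q" if "c \<in> carrier k" for c using x that by (simp add: p p_closed)
    show "(c \<oplus>\<^bsub>k\<^esub> d) \<odot>\<^bsub>Q\<^esub> u = c \<odot>\<^bsub>Q\<^esub> u \<oplus>\<^bsub>Q\<^esub> d \<odot>\<^bsub>Q\<^esub> u" "(c \<otimes>\<^bsub>k\<^esub> d) \<odot>\<^bsub>Q\<^esub> u = c \<odot>\<^bsub>Q\<^esub> (d \<odot>\<^bsub>Q\<^esub> u)"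
      if "c \<in> carrier k" "d \<in> carrier k" for c d
      using x that by (simp_all add: p M.smult_l_distr M.smult_assoc1)
    fix v assume "v \<in> carrier Q"
    then obtain y where y: "y \<in> carrier M" "v = p y" using ex by blast
    show "u \<oplus>\<^bsub>Q\<^esub> v \<in> carrier Q" using x y by (simp add: p p_closed)
    show "u \<oplus>\<^bsub>Q\<^esub> v = v \<oplus>\<^bsub>Q\<^esub> u" using x y by (simp add: p M.a_comm)
    show "c \<odot>\<^bsub>Q\<^esub> (u \<oplus>\<^bsub>Q\<^esub> v) = c \<odot>\<^bsub>Q\<^esub> u \<oplus>\<^bsub>Q\<^esub> c \<odot>\<^bsub>Q\<^esub> v" if "c \<in> carrier k" for c
      using x y that by (simp add: p M.smult_r_distr)
    fix w assume "w \<in> carrier Q"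
    then obtain z where z: "z \<in> carrier M" "w = p z" using ex by blast
    show "u \<oplus>\<^bsub>Q\<^esub> v \<oplus>\<^bsub>Q\<^esub> w = u \<oplus>\<^bsub>Q\<^esub> (v \<oplus>\<^bsub>Q\<^esub> w)" using x y z by (simp add: p M.a_assoc)
  qed
qed

lemma mod_hom_factor:
  assumes "module k M" "p \<in> mod_hom k M Q" "p ` carrier M = carrier Q"
    and "f \<in> mod_hom k M P" "\<And>x. x \<in> carrier M \<Longrightarrow> g (p x) = f x"
  shows "g \<in> mod_hom k Q P"
proof -
  interpret M: module k M by fact
  have ex: "\<exists>x\<in>carrier M. u = p x" if "u \<in> carrier Q" for u using that assms(3) by auto
  note p = mod_homD(2,3)[OF assms(2), symmetric]
  show ?thesis
  proof (rule mod_homI)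
    fix u assume "u \<in> carrier Q"
    then obtain x where x: "x \<in> carrier M" "u = p x" using ex by blast
    show "g u \<in> carrier P" using x by (simp add: assms(5) mod_homD[OF assms(4)])
    fix v assume "v \<in> carrier Q"
    then obtain y where y: "y \<in> carrier M" "v = p y" using ex by blast
    show "g (u \<oplus>\<^bsub>Q\<^esub> v) = g u \<oplus>\<^bsub>P\<^esub> g v"
      using x y by (simp add: p assms(5) mod_homD[OF assms(4)])
  next
    fix c u assume c: "c \<in> carrier k" and "u \<in> carrier Q"
    then obtain x where x: "x \<in> carrier M" "u = p x" using ex by blast
    show "g (c \<odot>\<^bsub>Q\<^esub> u) = c \<odot>\<^bsub>P\<^esub> g u"
      using x c by (simp add: p assms(5) mod_homD[OF assms(4)])
  qed
qed

lemma submodule_abelian_subgroup: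
  assumes "module k M" "submodule N k M"
  shows "abelian_subgroup N M"
proof -
  interpret M: module k M by fact
  show ?thesis
    using submodule.axioms(1)[OF assms(2)] M.abelian_group_axioms
    by (intro abelian_subgroupI3 additive_subgroupI)
qed

lemma quotient_coset_eq:
  assumes "module k M" "submodule N k M" "x \<in> carrier M" "y \<in> carrier M" "x \<ominus>\<^bsub>M\<^esub> y \<in> N"
  shows "N +>\<^bsub>M\<^esub> x = N +>\<^bsub>M\<^esub> y"
proof -
  interpret M: module k M by fact
  interpret N: abelian_subgroup N M by (rule submodule_abelian_subgroup[OF assms(1,2)])
  have "x \<in> N +>\<^bsub>M\<^esub> y" using assms(3-5) by (simp add: N.a_rcos_module M.minus_eq)
  then show ?thesis using N.a_repr_independence' assms(4) by simp
qed

lemma quotient_proj_hom: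
  assumes "module k M" "submodule N k M"
  shows "(\<lambda>x. N +>\<^bsub>M\<^esub> x) \<in> mod_hom k M (quotient_module M N)"
proof -
  interpret M: module k M by fact
  interpret N: abelian_subgroup N M by (rule submodule_abelian_subgroup[OF assms])
  \<comment> \<open>Scalar multiplication on the quotient is a union over all representatives. The
    cosets in it coincide, because representatives differ by elements of \<open>N\<close> and
    \<open>N\<close> is closed under scalars; and \<open>x\<close> itself is a representative, so
    the union is not empty.\<close>
  have smult: "(\<Union>y\<in>N +>\<^bsub>M\<^esub> x. N +>\<^bsub>M\<^esub> (c \<odot>\<^bsub>M\<^esub> y)) = N +>\<^bsub>M\<^esub> (c \<odot>\<^bsub>M\<^esub> x)"
    if c: "c \<in> carrier k" and x: "x \<in> carrier M" for c x
  proof -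
    have "N +>\<^bsub>M\<^esub> (c \<odot>\<^bsub>M\<^esub> y) = N +>\<^bsub>M\<^esub> (c \<odot>\<^bsub>M\<^esub> x)" if "y \<in> N +>\<^bsub>M\<^esub> x" for y
    proof -
      have y: "y \<in> carrier M" using N.a_elemrcos_carrier[OF x that] .
      have "y \<ominus>\<^bsub>M\<^esub> x \<in> N" using that N.a_rcos_module[OF x y] by (simp add: M.minus_eq)
      then have "c \<odot>\<^bsub>M\<^esub> (y \<ominus>\<^bsub>M\<^esub> x) \<in> N" using c by (rule submodule.smult_closed[OF assms(2), rotated])
      moreover have "c \<odot>\<^bsub>M\<^esub> (y \<ominus>\<^bsub>M\<^esub> x) = c \<odot>\<^bsub>M\<^esub> y \<ominus>\<^bsub>M\<^esub> c \<odot>\<^bsub>M\<^esub> x"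
        using c x y by (simp add: M.minus_eq M.smult_r_distr M.smult_r_minus)
      ultimately show ?thesis using c x y by (intro quotient_coset_eq[OF assms]) auto
    qed
    then show ?thesis using N.a_rcos_self[OF x] by blast
  qed
  show ?thesis
    by (intro mod_homI) (auto simp: quotient_module_def N.a_rcos_sum smult A_RCOSETS_def')
qed

lemma quotient_proj_surj:
  "(\<lambda>x. N +>\<^bsub>M\<^esub> x) ` carrier M = carrier (quotient_module M N)"
  by (auto simp: quotient_module_def A_RCOSETS_def')

lemma quotient_module_module:
  assumes "module k M" "submodule N k M"
  shows "module k (quotient_module M N)"
proof (rule module_image[OF assms(1) quotient_proj_hom[OF assms] quotient_proj_surj])
  interpret M: module k M by fact
  interpret N: abelian_subgroup N M by (rule submodule_abelian_subgroup[OF assms])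
  show "N +>\<^bsub>M\<^esub> \<zero>\<^bsub>M\<^esub> = \<zero>\<^bsub>quotient_module M N\<^esub>"
    by (simp add: quotient_module_def M.a_coset_add_zero N.a_subset)
qed

section \<open>Tensor products and their universal property\<close>

lemma tensor_free_module: "cring k \<Longrightarrow> module k (tensor_free k M N)"
  by (simp add: tensor_free_def free_module_module)

lemma tensor_free_basis:
  "\<lbrakk>cring k; x \<in> carrier M; y \<in> carrier N\<rbrakk> \<Longrightarrow> basis_vec k (x, y) \<in> carrier (tensor_free k M N)"
  by (simp add: tensor_free_def basis_vec_closed)

lemma tensor_gens_subsetI:
  fixes k :: "('k, 'r) ring_scheme" and M :: "('k, 'm, 's) module_scheme"
    and N :: "('k, 'n, 't) module_scheme"
  defines "b \<equiv> \<lambda>x y. basis_vec k (x, y)" and "F \<equiv> tensor_free k M N"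
  assumes "\<And>x x' y. \<lbrakk>x \<in> carrier M; x' \<in> carrier M; y \<in> carrier N\<rbrakk> \<Longrightarrow>
      b (x \<oplus>\<^bsub>M\<^esub> x') y \<ominus>\<^bsub>F\<^esub> (b x y \<oplus>\<^bsub>F\<^esub> b x' y) \<in> S"
    and "\<And>x y y'. \<lbrakk>x \<in> carrier M; y \<in> carrier N; y' \<in> carrier N\<rbrakk> \<Longrightarrow>
      b x (y \<oplus>\<^bsub>N\<^esub> y') \<ominus>\<^bsub>F\<^esub> (b x y \<oplus>\<^bsub>F\<^esub> b x y') \<in> S"
    and "\<And>c x y. \<lbrakk>c \<in> carrier k; x \<in> carrier M; y \<in> carrier N\<rbrakk> \<Longrightarrow>
      b (c \<odot>\<^bsub>M\<^esub> x) y \<ominus>\<^bsub>F\<^esub> c \<odot>\<^bsub>F\<^esub> b x y \<in> S"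
    and "\<And>c x y. \<lbrakk>c \<in> carrier k; x \<in> carrier M; y \<in> carrier N\<rbrakk> \<Longrightarrow>
      b x (c \<odot>\<^bsub>N\<^esub> y) \<ominus>\<^bsub>F\<^esub> c \<odot>\<^bsub>F\<^esub> b x y \<in> S"
  shows "tensor_gens k M N \<subseteq> S"
  using assms(3-) unfolding b_def F_def tensor_gens_def Let_def by blast

lemma tensor_rels_submodule:
  assumes "module k M" "module k N"
  shows "submodule (tensor_rels k M N) k (tensor_free k M N)"
proof -
  interpret M: module k M by fact
  interpret N: module k N by fact
  have k: "cring k" ..
  interpret F: module k "tensor_free k M N" by (rule tensor_free_module[OF k])
  have "tensor_gens k M N \<subseteq> carrier (tensor_free k M N)"
    by (rule tensor_gens_subsetI)
      (auto intro!: F.minus_closed F.add.m_closed F.smult_closed tensor_free_basis[OF k])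
  \<comment> \<open>The whole carrier is one of the submodules being intersected, which bounds the
    intersection from above.\<close>
  with F.carrier_is_submodule have sub: "tensor_rels k M N \<subseteq> carrier (tensor_free k M N)"
    unfolding tensor_rels_def by blast
  have zero: "\<zero>\<^bsub>tensor_free k M N\<^esub> \<in> S" if "submodule S k (tensor_free k M N)" for S
    using subgroup.one_closed[OF submodule.axioms(1)[OF that]] by simp
  show ?thesis
  proof (rule F.submoduleI[OF sub])
    show "\<zero>\<^bsub>tensor_free k M N\<^esub> \<in> tensor_rels k M N"
      unfolding tensor_rels_def by (blast intro: zero)
    show "\<ominus>\<^bsub>tensor_free k M N\<^esub> x \<in> tensor_rels k M N" if "x \<in> tensor_rels k M N" for x
      using that unfolding tensor_rels_def by (blast intro: F.submoduleE(3))
    show "x \<oplus>\<^bsub>tensor_free k M N\<^esub> y \<in> tensor_rels k M N"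
      if "x \<in> tensor_rels k M N" "y \<in> tensor_rels k M N" for x y
      using that unfolding tensor_rels_def by (blast intro: F.submoduleE(5))
    show "c \<odot>\<^bsub>tensor_free k M N\<^esub> x \<in> tensor_rels k M N"
      if "c \<in> carrier k" "x \<in> tensor_rels k M N" for c x
      using that unfolding tensor_rels_def by (blast intro: F.submoduleE(4))
  qed
qed

lemma tensor_product_module:
  assumes "module k M" "module k N"
  shows "module k (tensor_product k M N)"
proof -
  have "cring k" using assms(1) by (simp add: module_def)
  then show ?thesis unfolding tensor_product_def
    by (rule quotient_module_module[OF tensor_free_module tensor_rels_submodule[OF assms]])
qed

text \<open>Each additivity or homogeneity law compares two elements of the free module whose
  difference is one of the generators in \<open>tensor_gens\<close>, so their cosets are
  equal.\<close>

lemma pure_tensor_bilin: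
  assumes "module k M" "module k N"
  shows "pure_tensor k M N \<in> bilin k M N (tensor_product k M N)"
proof -
  interpret M: module k M by fact
  interpret N: module k N by fact
  have k: "cring k" ..
  let ?F = "tensor_free k M N" and ?R = "tensor_rels k M N" and ?T = "tensor_product k M N"
  interpret F: module k ?F by (rule tensor_free_module[OF k])
  note R = tensor_rels_submodule[OF assms]
  define p where "p = (\<lambda>f. ?R +>\<^bsub>?F\<^esub> f)"
  have p: "p \<in> mod_hom k ?F ?T"
    unfolding p_def tensor_product_def by (rule quotient_proj_hom[OF F.module_axioms R])
  note hom = mod_homD[OF p]
  have b [simp]: "x \<in> carrier M \<Longrightarrow> y \<in> carrier N \<Longrightarrow> basis_vec k (x, y) \<in> carrier ?F" for x y
    by (rule tensor_free_basis[OF k])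
  have gen: "p u = p v" if "u \<ominus>\<^bsub>?F\<^esub> v \<in> tensor_gens k M N" "u \<in> carrier ?F" "v \<in> carrier ?F" for u v
    unfolding p_def using that
    by (intro quotient_coset_eq[OF F.module_axioms R]) (auto simp: tensor_rels_def)
  have eq: "pure_tensor k M N x y = p (basis_vec k (x, y))" for x y
    by (simp add: pure_tensor_def p_def)
  show ?thesis
  proof (intro bilinI mod_homI)
    fix x y assume x: "x \<in> carrier M" and y: "y \<in> carrier N"
    show "pure_tensor k M N x y \<in> carrier ?T" "pure_tensor k M N x y \<in> carrier ?T"
      unfolding eq using x y by (auto intro: hom)
    show "pure_tensor k M N x (y \<oplus>\<^bsub>N\<^esub> y') = pure_tensor k M N x y \<oplus>\<^bsub>?T\<^esub> pure_tensor k M N x y'"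
      if y': "y' \<in> carrier N" for y'
    proof -
      have "p (basis_vec k (x, y \<oplus>\<^bsub>N\<^esub> y')) = p (basis_vec k (x, y) \<oplus>\<^bsub>?F\<^esub> basis_vec k (x, y'))"
        using x y y' by (intro gen) (auto simp: tensor_gens_def Let_def)
      then show ?thesis using x y y' by (simp add: eq hom)
    qed
    show "pure_tensor k M N (x \<oplus>\<^bsub>M\<^esub> x') y = pure_tensor k M N x y \<oplus>\<^bsub>?T\<^esub> pure_tensor k M N x' y"
      if x': "x' \<in> carrier M" for x'
    proof -
      have "p (basis_vec k (x \<oplus>\<^bsub>M\<^esub> x', y)) = p (basis_vec k (x, y) \<oplus>\<^bsub>?F\<^esub> basis_vec k (x', y))"
        using x y x' by (intro gen) (auto simp: tensor_gens_def Let_def)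
      then show ?thesis using x y x' by (simp add: eq hom)
    qed
    fix c assume c: "c \<in> carrier k"
    have "p (basis_vec k (c \<odot>\<^bsub>M\<^esub> x, y)) = p (c \<odot>\<^bsub>?F\<^esub> basis_vec k (x, y))"
      using x y c by (intro gen) (auto simp: tensor_gens_def Let_def)
    then show "pure_tensor k M N (c \<odot>\<^bsub>M\<^esub> x) y = c \<odot>\<^bsub>?T\<^esub> pure_tensor k M N x y"
      using x y c by (simp add: eq hom)
    have "p (basis_vec k (x, c \<odot>\<^bsub>N\<^esub> y)) = p (c \<odot>\<^bsub>?F\<^esub> basis_vec k (x, y))"
      using x y c by (intro gen) (auto simp: tensor_gens_def Let_def)
    then show "pure_tensor k M N x (c \<odot>\<^bsub>N\<^esub> y) = c \<odot>\<^bsub>?T\<^esub> pure_tensor k M N x y"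
      using x y c by (simp add: eq hom)
  qed
qed

text \<open>The projection from the free module is onto and sends basis vectors to pure tensors, so
  composing with it turns the claim into agreement of two linear maps on a basis.\<close>

lemma tensor_hom_eq:
  assumes "module k M" "module k N" "module k P"
    and "f \<in> mod_hom k (tensor_product k M N) P" "g \<in> mod_hom k (tensor_product k M N) P"
    and "\<And>x y. \<lbrakk>x \<in> carrier M; y \<in> carrier N\<rbrakk> \<Longrightarrow>
      f (pure_tensor k M N x y) = g (pure_tensor k M N x y)"
    and "t \<in> carrier (tensor_product k M N)"
  shows "f t = g t"
proof -
  have k: "cring k" using assms(1) by (simp add: module_def)
  let ?F = "tensor_free k M N"
  define p where "p = (\<lambda>f. tensor_rels k M N +>\<^bsub>?F\<^esub> f)"
  note R = tensor_free_module[OF k] tensor_rels_submodule[OF assms(1,2)]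
  have p: "p \<in> mod_hom k ?F (tensor_product k M N)"
    unfolding p_def tensor_product_def by (rule quotient_proj_hom[OF R])
  obtain h where h: "h \<in> carrier ?F" "t = p h"
    using assms(7) unfolding p_def tensor_product_def by (auto simp: quotient_proj_surj[symmetric])
  have "f (p h) = g (p h)"
    by (rule free_module_hom_eq[OF assms(3) mod_hom_compose[OF p assms(4), unfolded tensor_free_def]
        mod_hom_compose[OF p assms(5), unfolded tensor_free_def]])
      (use h assms(6) in \<open>auto simp: p_def pure_tensor_def tensor_free_def\<close>)
  then show ?thesis using h by simp
qed

text \<open>The universal property of the tensor product. The linear extension \<open>L\<close> of
  \<open>\<phi>\<close> vanishes on the relations, hence is constant on every coset, and
  \<open>the_elem\<close> picks its only value there.\<close>

lemma tensor_lift: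
  assumes "module k M" "module k N" "module k P" "\<phi> \<in> bilin k M N P"
  shows tensor_lift_hom: "tensor_lift k P \<phi> \<in> mod_hom k (tensor_product k M N) P"
    and tensor_lift_pure: "\<And>x y. \<lbrakk>x \<in> carrier M; y \<in> carrier N\<rbrakk> \<Longrightarrow>
      tensor_lift k P \<phi> (pure_tensor k M N x y) = \<phi> x y"
proof -
  interpret M: module k M by fact
  interpret N: module k N by fact
  interpret P: module k P by fact
  have k: "cring k" ..
  let ?F = "tensor_free k M N" and ?R = "tensor_rels k M N" and ?T = "tensor_product k M N"
  interpret F: module k ?F by (rule tensor_free_module[OF k])
  note R = tensor_rels_submodule[OF assms(1,2)]
  define p where "p = (\<lambda>f. ?R +>\<^bsub>?F\<^esub> f)"
  define L where "L = lin_ext k P (\<lambda>(x, y). \<phi> x y)"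
  note closed = bilin_closed[OF assms(4)]
  have L: "L \<in> mod_hom k ?F P"
    unfolding L_def tensor_free_def by (rule lin_ext_hom[OF assms(3)]) (auto intro: closed)
  have basis: "L (basis_vec k (x, y)) = \<phi> x y" if "x \<in> carrier M" "y \<in> carrier N" for x y
    unfolding L_def using that by (subst lin_ext_basis_vec[OF assms(3)]) (auto intro: closed)
  have b [simp]: "x \<in> carrier M \<Longrightarrow> y \<in> carrier N \<Longrightarrow> basis_vec k (x, y) \<in> carrier ?F" for x y
    by (rule tensor_free_basis[OF k])
  note kernel = mod_hom_kernel_submodule[OF F.module_axioms assms(3) L]
  note minus = mod_hom_minus[OF F.module_axioms assms(3) L]
  \<comment> \<open>By bilinearity \<open>L\<close> kills each generator; its kernel is then one of
    the submodules whose intersection is \<open>tensor_rels\<close>.\<close>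
  have "tensor_gens k M N \<subseteq> {f \<in> carrier ?F. L f = \<zero>\<^bsub>P\<^esub>}"
    by (rule tensor_gens_subsetI)
      (auto intro!: F.minus_closed simp: minus basis closed mod_homD[OF L] P.r_neg P.minus_eq
        mod_homD[OF bilin_left[OF assms(4)]] mod_homD[OF bilin_right[OF assms(4)]])
  with kernel have sub: "?R \<subseteq> {f \<in> carrier ?F. L f = \<zero>\<^bsub>P\<^esub>}"
    unfolding tensor_rels_def by blast
  have "L ` p f = {L f}" if f: "f \<in> carrier ?F" for f
  proof -
    interpret N: abelian_subgroup ?R ?F by (rule submodule_abelian_subgroup[OF F.module_axioms R])
    have "L (r \<oplus>\<^bsub>?F\<^esub> f) = L f" if "r \<in> ?R" for r
    proof -
      have "r \<in> carrier ?F" "L r = \<zero>\<^bsub>P\<^esub>" using that sub by auto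
      then show ?thesis using f by (simp add: mod_homD[OF L])
    qed
    moreover have "f \<in> p f" unfolding p_def by (rule N.a_rcos_self[OF f])
    ultimately show ?thesis unfolding p_def a_r_coset_def' by auto
  qed
  then have eq: "tensor_lift k P \<phi> (p f) = L f" if "f \<in> carrier ?F" for f
    using that by (simp add: tensor_lift_def L_def)
  show "tensor_lift k P \<phi> \<in> mod_hom k ?T P"
    unfolding tensor_product_def
    by (rule mod_hom_factor[OF F.module_axioms quotient_proj_hom[OF F.module_axioms R]
        quotient_proj_surj L]) (use eq in \<open>auto simp: p_def\<close>)
  show "tensor_lift k P \<phi> (pure_tensor k M N x y) = \<phi> x y" if "x \<in> carrier M" "y \<in> carrier N" for x y
    using that eq[of "basis_vec k (x, y)"] by (simp add: basis p_def pure_tensor_def)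
qed


section \<open>The bialgebra structure of a group algebra\<close>

lemma ring_as_module_module:
  assumes "cring k"
  shows "module k (ring_as_module k)"
proof -
  interpret k: cring k by fact
  have "\<exists>y\<in>carrier k. y \<oplus>\<^bsub>k\<^esub> x = \<zero>\<^bsub>k\<^esub>" if "x \<in> carrier k" for x
    using that k.l_neg k.a_inv_closed by blast
  then show ?thesis
    by (intro moduleI abelian_groupI)
      (auto simp: ring_as_module_def assms k.l_distr k.r_distr k.a_ac k.m_ac)
qed

lemma assoc_algebra_mult_bilin:
  assumes "assoc_algebra k A"
  shows "(\<lambda>x y. x \<otimes>\<^bsub>A\<^esub> y) \<in> bilin k A A A"
proof -
  interpret A: assoc_algebra k A by fact
  show ?thesis
    by (intro bilinI mod_homI)
      (auto simp: A.smult_mult_left A.smult_mult_right A.l_distr A.r_distr)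
qed

lemma group_algebra_simps [simp]:
  "carrier (group_algebra k G) = carrier (free_module k (carrier G))"
  "zero (group_algebra k G) = zero (free_module k (carrier G))"
  "add (group_algebra k G) = add (free_module k (carrier G))"
  "smult (group_algebra k G) = smult (free_module k (carrier G))"
  "one (group_algebra k G) = basis_vec k \<one>\<^bsub>G\<^esub>"
  by (simp_all add: group_algebra_def Let_def del: free_module_simps)

text \<open>The two records differ in their product, unit and coalgebra fields, which linearity does
  not see. With the analogous facts on bilinear maps and tensor products, this transfers results on
  free modules to the group algebra.\<close>

lemma group_algebra_mod_hom:
  "mod_hom k (group_algebra k G) P = mod_hom k (free_module k (carrier G)) P"
  "mod_hom k M (group_algebra k G) = mod_hom k M (free_module k (carrier G))"
  by (simp_all add: mod_hom_def)

lemma group_algebra_bilin: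
  "bilin k (group_algebra k G) N P = bilin k (free_module k (carrier G)) N P"
  "bilin k M (group_algebra k G) P = bilin k M (free_module k (carrier G)) P"
  "bilin k M N (group_algebra k G) = bilin k M N (free_module k (carrier G))"
  by (simp_all add: bilin_def group_algebra_mod_hom)

text \<open>The comultiplication of \<open>group_algebra\<close> is built in the tensor square of
  the free module, whereas the bialgebra axioms refer to that of the algebra record. Only carrier,
  addition and scalars enter the construction, so the two coincide.\<close>

lemma group_algebra_tensor:
  "tensor_product k (group_algebra k G) (group_algebra k G) =
    tensor_product k (free_module k (carrier G)) (free_module k (carrier G))"
  "pure_tensor k (group_algebra k G) (group_algebra k G) =
    pure_tensor k (free_module k (carrier G)) (free_module k (carrier G))"
proof -
  have free: "tensor_free k (group_algebra k G) (group_algebra k G) =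
      tensor_free k (free_module k (carrier G)) (free_module k (carrier G))"
    by (simp add: tensor_free_def)
  have rels: "tensor_rels k (group_algebra k G) (group_algebra k G) =
      tensor_rels k (free_module k (carrier G)) (free_module k (carrier G))"
    by (simp add: tensor_rels_def tensor_gens_def free del: free_module_simps)
  show "tensor_product k (group_algebra k G) (group_algebra k G) =
      tensor_product k (free_module k (carrier G)) (free_module k (carrier G))"
    by (simp add: tensor_product_def free rels)
  show "pure_tensor k (group_algebra k G) (group_algebra k G) =
      pure_tensor k (free_module k (carrier G)) (free_module k (carrier G))"
    by (intro ext) (simp add: pure_tensor_def free rels)
qed

section \<open>The group algebra of a group over a commutative ring\<close>

locale cring_group = k: cring k + G: group G
  for k :: "('k, 'r) ring_scheme" and G :: "('g, 's) monoid_scheme"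
begin

abbreviation "F \<equiv> free_module k (carrier G)"
abbreviation "H \<equiv> group_algebra k G"
abbreviation "b \<equiv> basis_vec k :: 'g \<Rightarrow> 'g \<Rightarrow> 'k"
abbreviation "HH \<equiv> tensor_product k H H"

lemma F_module: "module k F"
  by (rule free_module_module) unfold_locales

text \<open>The identity is a surjective homomorphism from the free module to the group algebra, so
  \<open>module_image\<close> applies.\<close>

lemma H_module: "module k H"
  by (rule module_image[OF F_module, where p = "\<lambda>x. x"])
    (auto simp: group_algebra_mod_hom mod_hom_id)

lemma HH_module: "module k HH"
  by (rule tensor_product_module[OF H_module H_module])

lemma basis_closed [simp]: "\<sigma> \<in> carrier G \<Longrightarrow> b \<sigma> \<in> carrier F"
  by (rule basis_vec_closed) unfold_locales

lemma H_hom_eq: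
  assumes "module k P" "f \<in> mod_hom k H P" "g \<in> mod_hom k H P"
    and "\<And>\<sigma>. \<sigma> \<in> carrier G \<Longrightarrow> f (b \<sigma>) = g (b \<sigma>)" and "h \<in> carrier H"
  shows "f h = g h"
  using free_module_hom_eq[OF assms(1), of f "carrier G" g h] assms(2-)
  by (simp add: group_algebra_mod_hom)

lemma H_bilin_eq:
  assumes "module k P" "\<phi> \<in> bilin k H H P" "\<psi> \<in> bilin k H H P"
    and "\<And>\<sigma> \<tau>. \<lbrakk>\<sigma> \<in> carrier G; \<tau> \<in> carrier G\<rbrakk> \<Longrightarrow> \<phi> (b \<sigma>) (b \<tau>) = \<psi> (b \<sigma>) (b \<tau>)"
    and "g \<in> carrier H" "h \<in> carrier H"
  shows "\<phi> g h = \<psi> g h"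
  using free_module_bilin_eq[OF assms(1), of \<phi> "carrier G" "carrier G" \<psi> g h] assms(2-)
  by (simp add: group_algebra_bilin)

lemma H_mult_bilin: "mult H \<in> bilin k H H H"
proof -
  have "(\<lambda>x y. lin_ext k F (\<lambda>\<sigma>. lin_ext k F (\<lambda>\<tau>. b (\<sigma> \<otimes>\<^bsub>G\<^esub> \<tau>)) y) x) \<in> bilin k F F F"
    by (intro lin_ext_bilin[OF F_module _ F_module] lin_ext_hom[OF F_module]) auto
  then show ?thesis
    unfolding group_algebra_bilin by (simp add: group_algebra_def Let_def)
qed

lemma H_mult_basis:
  assumes "\<sigma> \<in> carrier G" "\<tau> \<in> carrier G"
  shows "b \<sigma> \<otimes>\<^bsub>H\<^esub> b \<tau> = b (\<sigma> \<otimes>\<^bsub>G\<^esub> \<tau>)"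
  using assms lin_ext_basis_vec[OF F_module, of "\<lambda>\<tau>. b (\<sigma> \<otimes>\<^bsub>G\<^esub> \<tau>)" \<tau>]
  by (simp add: group_algebra_def Let_def lin_ext_basis_vec[OF F_module])

lemma H_assoc_algebra: "assoc_algebra k H"
proof -
  interpret H: module k H by (rule H_module)
  note hom_left = bilin_left[OF H_mult_bilin] and hom_right = bilin_right[OF H_mult_bilin]
  note left = mod_homD[OF hom_left] and right = mod_homD[OF hom_right]
  \<comment> \<open>The trilinear identity is tested in two rounds: for fixed \<open>z\<close> on
    group elements in the first two places and then, with these fixed, on group elements in the
    third, where associativity in \<open>G\<close> applies.\<close>
  have assoc: "(x \<otimes>\<^bsub>H\<^esub> y) \<otimes>\<^bsub>H\<^esub> z = x \<otimes>\<^bsub>H\<^esub> (y \<otimes>\<^bsub>H\<^esub> z)"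
    if x: "x \<in> carrier H" and y: "y \<in> carrier H" and z: "z \<in> carrier H" for x y z
  proof (rule H_bilin_eq[OF H_module mod_hom_bilin[OF H_mult_bilin hom_left[OF z]]
        bilin_compose[OF mod_hom_id hom_left[OF z] H_mult_bilin] _ x y])
    fix \<sigma> \<tau> assume st: "\<sigma> \<in> carrier G" "\<tau> \<in> carrier G"
    then have "b \<sigma> \<in> carrier H" "b \<tau> \<in> carrier H" "b \<sigma> \<otimes>\<^bsub>H\<^esub> b \<tau> \<in> carrier H"
      by (auto simp: H_mult_basis)
    note b = this
    show "(b \<sigma> \<otimes>\<^bsub>H\<^esub> b \<tau>) \<otimes>\<^bsub>H\<^esub> z = b \<sigma> \<otimes>\<^bsub>H\<^esub> (b \<tau> \<otimes>\<^bsub>H\<^esub> z)"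
      by (rule H_hom_eq[OF H_module hom_right[OF b(3)]
          mod_hom_compose[OF hom_right[OF b(2)] hom_right[OF b(1)]] _ z])
        (use st in \<open>auto simp: H_mult_basis G.m_assoc\<close>)
  qed
  have one: "\<one>\<^bsub>H\<^esub> \<in> carrier H" by simp
  have l_one: "\<one>\<^bsub>H\<^esub> \<otimes>\<^bsub>H\<^esub> x = x" and r_one: "x \<otimes>\<^bsub>H\<^esub> \<one>\<^bsub>H\<^esub> = x" if x: "x \<in> carrier H" for x
    by (rule H_hom_eq[OF H_module hom_right[OF one] mod_hom_id _ x], simp add: H_mult_basis)
      (rule H_hom_eq[OF H_module hom_left[OF one] mod_hom_id _ x], simp add: H_mult_basis)
  have "ring H"
  proof (rule ringI)
    show "abelian_group H" ..
    show "monoid H" using left right assoc one l_one r_one by (intro monoidI) auto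
  qed (use left right in auto)
  then show ?thesis
    using H_module left right by (intro assoc_algebra.intro assoc_algebra_axioms.intro) auto
qed

section \<open>Comultiplication, Sweedler sums and counit\<close>

lemma comult_hom: "comult H \<in> mod_hom k H HH"
  and comult_basis: "\<sigma> \<in> carrier G \<Longrightarrow> comult H (b \<sigma>) = pure_tensor k H H (b \<sigma>) (b \<sigma>)"
proof -
  have eq: "comult H = lin_ext k HH (\<lambda>\<sigma>. pure_tensor k H H (b \<sigma>) (b \<sigma>))"
    unfolding group_algebra_tensor by (simp add: group_algebra_def Let_def)
  have closed: "pure_tensor k H H (b \<sigma>) (b \<sigma>) \<in> carrier HH" if "\<sigma> \<in> carrier G" for \<sigma>
    using that by (intro bilin_closed[OF pure_tensor_bilin[OF H_module H_module]]) auto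
  show "comult H \<in> mod_hom k H HH"
    unfolding eq group_algebra_mod_hom
    by (rule lin_ext_hom[OF HH_module]) (use closed in auto)
  show "\<sigma> \<in> carrier G \<Longrightarrow> comult H (b \<sigma>) = pure_tensor k H H (b \<sigma>) (b \<sigma>)"
    unfolding eq using closed by (intro lin_ext_basis_vec[OF HH_module])
qed

lemma sweedler_hom:
  assumes "module k P" "\<phi> \<in> bilin k H H P"
  shows "sweedler k H P \<phi> \<in> mod_hom k H P"
  using mod_hom_compose[OF comult_hom tensor_lift_hom[OF H_module H_module assms]]
  unfolding sweedler_def .

text \<open>\<open>b \<sigma>\<close> is grouplike, so its comultiplication is a single pure tensor
  and the Sweedler sum has only one term.\<close>

lemma sweedler_basis:
  assumes "module k P" "\<phi> \<in> bilin k H H P" "\<sigma> \<in> carrier G"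
  shows "sweedler k H P \<phi> (b \<sigma>) = \<phi> (b \<sigma>) (b \<sigma>)"
  using assms(3) by (simp add: sweedler_def comult_basis
      tensor_lift_pure[OF H_module H_module assms(1,2)])

text \<open>Meant for nested Sweedler sums, whose inner sum depends on a further variable
  \<open>m\<close>. Linearity in \<open>m\<close> holds for every \<open>h\<close> because both
  sides are linear in \<open>h\<close> and agree on group elements.\<close>

lemma sweedler_bilin:
  assumes "module k P" "module k M"
    and "\<And>m. m \<in> carrier M \<Longrightarrow> \<psi> m \<in> bilin k H H P"
    and "\<And>x y. \<lbrakk>x \<in> carrier H; y \<in> carrier H\<rbrakk> \<Longrightarrow> (\<lambda>m. \<psi> m x y) \<in> mod_hom k M P"
  shows "(\<lambda>h m. sweedler k H P (\<psi> m) h) \<in> bilin k H M P"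
proof (rule bilinI)
  interpret M: module k M by fact
  note hom = sweedler_hom[OF assms(1,3)] and basis = sweedler_basis[OF assms(1,3)]
  note D = mod_homD[OF assms(4)]
  show "sweedler k H P (\<psi> m) \<in> mod_hom k H P" if "m \<in> carrier M" for m
    by (rule hom[OF that])
  fix h assume h: "h \<in> carrier H"
  show "(\<lambda>m. sweedler k H P (\<psi> m) h) \<in> mod_hom k M P"
  proof (rule mod_homI)
    fix m assume m: "m \<in> carrier M"
    show "sweedler k H P (\<psi> m) h \<in> carrier P" by (rule mod_homD(1)[OF hom[OF m] h])
    fix n assume n: "n \<in> carrier M"
    show "sweedler k H P (\<psi> (m \<oplus>\<^bsub>M\<^esub> n)) h = sweedler k H P (\<psi> m) h \<oplus>\<^bsub>P\<^esub> sweedler k H P (\<psi> n) h"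
      by (rule H_hom_eq[OF assms(1) hom mod_hom_add[OF assms(1) hom hom] _ h])
        (use m n D in \<open>auto simp: basis\<close>)
  next
    fix c m assume c: "c \<in> carrier k" and m: "m \<in> carrier M"
    show "sweedler k H P (\<psi> (c \<odot>\<^bsub>M\<^esub> m)) h = c \<odot>\<^bsub>P\<^esub> sweedler k H P (\<psi> m) h"
      by (rule H_hom_eq[OF assms(1) hom mod_hom_smult[OF assms(1) c hom] _ h])
        (use m c D in \<open>auto simp: basis\<close>)
  qed
qed

lemma counit_hom: "counit H \<in> mod_hom k H (ring_as_module k)"
  and counit_basis: "\<sigma> \<in> carrier G \<Longrightarrow> counit H (b \<sigma>) = \<one>\<^bsub>k\<^esub>"
proof -
  have eq: "counit H = lin_ext k (ring_as_module k) (\<lambda>_. \<one>\<^bsub>k\<^esub>)"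
    by (simp add: group_algebra_def Let_def)
  have R: "module k (ring_as_module k)" by (rule ring_as_module_module) unfold_locales
  show "counit H \<in> mod_hom k H (ring_as_module k)"
    unfolding eq group_algebra_mod_hom
    by (rule lin_ext_hom[OF R]) (auto simp: ring_as_module_def)
  show "\<sigma> \<in> carrier G \<Longrightarrow> counit H (b \<sigma>) = \<one>\<^bsub>k\<^esub>"
    unfolding eq by (subst lin_ext_basis_vec[OF R]) (auto simp: ring_as_module_def)
qed

text \<open>Coassociativity, the counit laws and multiplicativity equate linear or bilinear maps, so
  they are tested on group elements, where Sweedler sums have one term. Most of the work is to see
  that each expression under a Sweedler sum is bilinear, as \<open>sweedler_hom\<close> and
  \<open>sweedler_basis\<close> demand.\<close>

lemma group_algebra_bialgebra: "bialgebra k H"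
proof (intro bialgebra.intro bialgebra_axioms.intro)
  interpret H: assoc_algebra k H by (rule H_assoc_algebra)
  let ?T = "tensor_product k H HH"
  have T: "module k ?T" by (rule tensor_product_module[OF H_module HH_module])
  have R: "module k (ring_as_module k)" by (rule ring_as_module_module) unfold_locales
  note pure = pure_tensor_bilin[OF H_module H_module]
    and pure' = pure_tensor_bilin[OF H_module HH_module]
  have b: "\<sigma> \<in> carrier G \<Longrightarrow> b \<sigma> \<in> carrier H" for \<sigma> by simp
  show "assoc_algebra k H" by (rule H_assoc_algebra)
  show "comult H \<in> mod_hom k H HH" by (rule comult_hom)
  show "counit H \<in> mod_hom k H (ring_as_module k)" by (rule counit_hom)
  show "comult H \<one>\<^bsub>H\<^esub> = pure_tensor k H H \<one>\<^bsub>H\<^esub> \<one>\<^bsub>H\<^esub>" by (simp add: comult_basis)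
  show "counit H \<one>\<^bsub>H\<^esub> = \<one>\<^bsub>k\<^esub>" by (simp add: counit_basis)
  fix h assume h: "h \<in> carrier H"
  have L: "(\<lambda>u v. pure_tensor k H HH u (pure_tensor k H H v y)) \<in> bilin k H H ?T" if "y \<in> carrier H" for y
    by (rule bilin_compose[OF mod_hom_id bilin_left[OF pure that] pure'])
  have L': "(\<lambda>x y. sweedler k H ?T (\<lambda>u v. pure_tensor k H HH u (pure_tensor k H H v y)) x) \<in> bilin k H H ?T"
    by (rule sweedler_bilin[OF T H_module L])
      (auto intro: mod_hom_compose[OF bilin_right[OF pure] bilin_right[OF pure']])
  have R': "(\<lambda>x y. pure_tensor k H HH x (comult H y)) \<in> bilin k H H ?T"
    by (rule bilin_compose[OF mod_hom_id comult_hom pure'])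
  show "sweedler k H ?T
        (\<lambda>x y. sweedler k H ?T (\<lambda>u v. pure_tensor k H HH u (pure_tensor k H H v y)) x) h =
      sweedler k H ?T (\<lambda>x y. pure_tensor k H HH x (comult H y)) h"
    by (rule H_hom_eq[OF T sweedler_hom[OF T L'] sweedler_hom[OF T R'] _ h])
      (simp add: sweedler_basis[OF T L'] sweedler_basis[OF T R'] sweedler_basis[OF T L[OF b]]
        comult_basis)
  note CL = smult_bilin(1)[OF H_module counit_hom mod_hom_id]
    and CR = smult_bilin(2)[OF H_module counit_hom mod_hom_id]
  have one: "\<one>\<^bsub>k\<^esub> \<odot>\<^bsub>H\<^esub> b \<sigma> = b \<sigma>" if "\<sigma> \<in> carrier G" for \<sigma>
    using that by (intro H.smult_one b)
  show "sweedler k H H (\<lambda>x y. counit H x \<odot>\<^bsub>H\<^esub> y) h = h"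
    by (rule H_hom_eq[OF H_module sweedler_hom[OF H_module CL] mod_hom_id _ h])
      (simp add: sweedler_basis[OF H_module CL] counit_basis one del: group_algebra_simps)
  show "sweedler k H H (\<lambda>x y. counit H y \<odot>\<^bsub>H\<^esub> x) h = h"
    by (rule H_hom_eq[OF H_module sweedler_hom[OF H_module CR] mod_hom_id _ h])
      (simp add: sweedler_basis[OF H_module CR] counit_basis one del: group_algebra_simps)
  fix g assume g: "g \<in> carrier H"
  \<comment> \<open>The expression depends on four variables. It is bilinear in \<open>h1\<close>,
    \<open>h2\<close> for fixed \<open>g1\<close>, \<open>g2\<close>; the inner sum is then bilinear
    in \<open>g1\<close>, \<open>g2\<close> for fixed \<open>h\<close>, obtained one variable at a
    time; finally the double sum is bilinear in \<open>g\<close>, \<open>h\<close>.\<close>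
  have inner: "(\<lambda>h1 h2. pure_tensor k H H (g1 \<otimes>\<^bsub>H\<^esub> h1) (g2 \<otimes>\<^bsub>H\<^esub> h2)) \<in> bilin k H H HH"
    if "g1 \<in> carrier H" "g2 \<in> carrier H" for g1 g2
    by (rule bilin_compose[OF bilin_right[OF H_mult_bilin that(1)]
        bilin_right[OF H_mult_bilin that(2)] pure])
  have outer_left: "(\<lambda>h g1. sweedler k H HH
      (\<lambda>h1 h2. pure_tensor k H H (g1 \<otimes>\<^bsub>H\<^esub> h1) (g2 \<otimes>\<^bsub>H\<^esub> h2)) h) \<in> bilin k H H HH"
    if "g2 \<in> carrier H" for g2
    using that
    by (intro sweedler_bilin[OF HH_module H_module inner]
        mod_hom_compose[OF bilin_left[OF H_mult_bilin] bilin_left[OF pure]])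
      (auto intro: bilin_closed[OF H_mult_bilin, simplified])
  have outer_right: "(\<lambda>h g2. sweedler k H HH
      (\<lambda>h1 h2. pure_tensor k H H (g1 \<otimes>\<^bsub>H\<^esub> h1) (g2 \<otimes>\<^bsub>H\<^esub> h2)) h) \<in> bilin k H H HH"
    if "g1 \<in> carrier H" for g1
    using that
    by (intro sweedler_bilin[OF HH_module H_module inner]
        mod_hom_compose[OF bilin_left[OF H_mult_bilin] bilin_right[OF pure]])
      (auto intro: bilin_closed[OF H_mult_bilin, simplified])
  have outer: "(\<lambda>g1 g2. sweedler k H HH
      (\<lambda>h1 h2. pure_tensor k H H (g1 \<otimes>\<^bsub>H\<^esub> h1) (g2 \<otimes>\<^bsub>H\<^esub> h2)) h) \<in> bilin k H H HH"
    if "h \<in> carrier H" for h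
    by (rule bilinI) (rule bilin_right[OF outer_right that], assumption,
        rule bilin_right[OF outer_left that], assumption)
  have rhs: "(\<lambda>g h. sweedler k H HH (\<lambda>g1 g2. sweedler k H HH
      (\<lambda>h1 h2. pure_tensor k H H (g1 \<otimes>\<^bsub>H\<^esub> h1) (g2 \<otimes>\<^bsub>H\<^esub> h2)) h) g) \<in> bilin k H H HH"
    by (intro sweedler_bilin[OF HH_module H_module outer] sweedler_hom[OF HH_module inner])
  show "comult H (g \<otimes>\<^bsub>H\<^esub> h) = sweedler k H HH (\<lambda>g1 g2. sweedler k H HH
      (\<lambda>h1 h2. pure_tensor k H H (g1 \<otimes>\<^bsub>H\<^esub> h1) (g2 \<otimes>\<^bsub>H\<^esub> h2)) h) g"
    by (rule H_bilin_eq[OF HH_module mod_hom_bilin[OF H_mult_bilin comult_hom] rhs _ g h])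
      (simp add: sweedler_basis[OF HH_module outer[OF b]] sweedler_basis[OF HH_module inner[OF b b]]
        H_mult_basis comult_basis)
  \<comment> \<open>Scalar multiplication on \<open>k\<close> as a module over itself is the product
    of \<open>k\<close>, so this is another instance of \<open>smult_bilin\<close>.\<close>
  have "(\<lambda>g h. counit H g \<otimes>\<^bsub>k\<^esub> counit H h) \<in> bilin k H H (ring_as_module k)"
    using smult_bilin(1)[OF R counit_hom counit_hom] by (simp add: ring_as_module_def)
  from H_bilin_eq[OF R mod_hom_bilin[OF H_mult_bilin counit_hom] this _ g h]
  show "counit H (g \<otimes>\<^bsub>H\<^esub> h) = counit H g \<otimes>\<^bsub>k\<^esub> counit H h"
    by (simp add: H_mult_basis counit_basis)
qed

end


section \<open>Partial actions by endomorphisms\<close>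

text \<open>
  The middle term of the correspondence: \<open>\<theta> \<sigma> a\<close> is both \<open>\<sigma> \<cdot> a\<close> for a partial \<open>kG\<close>-action and
  \<open>\<alpha> \<sigma> (e (inv \<sigma>) a)\<close> for a partial \<open>G\<close>-action.
\<close>

locale partial_endo_action =
  G: group G + A: assoc_algebra k A for k (structure) and G (structure) and A (structure) +
  fixes \<theta> :: "'c \<Rightarrow> 'd \<Rightarrow> 'd"
  assumes hom: "\<sigma> \<in> carrier G \<Longrightarrow> \<theta> \<sigma> \<in> mod_hom k A A"
    and mult: "\<lbrakk>\<sigma> \<in> carrier G; a \<in> carrier A; b \<in> carrier A\<rbrakk> \<Longrightarrow>
      \<theta> \<sigma> (a \<otimes>\<^bsub>A\<^esub> b) = \<theta> \<sigma> a \<otimes>\<^bsub>A\<^esub> \<theta> \<sigma> b"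
    and mult_act: "\<lbrakk>\<sigma> \<in> carrier G; \<tau> \<in> carrier G; a \<in> carrier A; b \<in> carrier A\<rbrakk> \<Longrightarrow>
      \<theta> \<sigma> (a \<otimes>\<^bsub>A\<^esub> \<theta> \<tau> b) = \<theta> \<sigma> a \<otimes>\<^bsub>A\<^esub> \<theta> (\<sigma> \<otimes>\<^bsub>G\<^esub> \<tau>) b"
    and one: "a \<in> carrier A \<Longrightarrow> \<theta> \<one>\<^bsub>G\<^esub> a = a"

context partial_endo_action
begin

section \<open>Idempotents and the right ideals they generate\<close>

abbreviation "\<epsilon> \<sigma> \<equiv> \<theta> \<sigma> \<one>\<^bsub>A\<^esub>"

lemma closed [simp]: "\<sigma> \<in> carrier G \<Longrightarrow> a \<in> carrier A \<Longrightarrow> \<theta> \<sigma> a \<in> carrier A"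
  by (rule mod_homD(1)[OF hom])

lemma unit_left: "\<sigma> \<in> carrier G \<Longrightarrow> a \<in> carrier A \<Longrightarrow> \<epsilon> \<sigma> \<otimes>\<^bsub>A\<^esub> \<theta> \<sigma> a = \<theta> \<sigma> a"
  using mult[of \<sigma> "\<one>\<^bsub>A\<^esub>" a] by simp

text \<open>The unit as first factor in \<open>mult_act\<close>. This is what
  \<open>alpha_comp\<close> says in terms of \<open>\<theta>\<close>.\<close>

lemma comp:
  assumes "\<sigma> \<in> carrier G" "\<tau> \<in> carrier G" "a \<in> carrier A"
  shows "\<theta> \<sigma> (\<theta> \<tau> a) = \<epsilon> \<sigma> \<otimes>\<^bsub>A\<^esub> \<theta> (\<sigma> \<otimes>\<^bsub>G\<^esub> \<tau>) a"
  using mult_act[of \<sigma> \<tau> "\<one>\<^bsub>A\<^esub>" a] assms by simp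

lemma comp_inv:
  assumes "\<sigma> \<in> carrier G" "a \<in> carrier A"
  shows "\<theta> \<sigma> (\<theta> (inv\<^bsub>G\<^esub> \<sigma>) a) = \<epsilon> \<sigma> \<otimes>\<^bsub>A\<^esub> a"
  using comp[of \<sigma> "inv\<^bsub>G\<^esub> \<sigma>" a] assms by (simp add: one)

text \<open>By multiplicativity and \<open>comp_inv\<close> the left side is
  \<open>\<epsilon> \<sigma>\<close> times \<open>\<theta> \<sigma> a\<close>, and
  \<open>\<epsilon> \<sigma>\<close> is a left identity on the image. Hence
  \<open>\<theta> \<sigma>\<close> is determined by its restriction to the right ideal of
  \<open>\<epsilon> (inv \<sigma>)\<close>.\<close>

lemma act_unit:
  assumes "\<sigma> \<in> carrier G" "a \<in> carrier A"
  shows "\<theta> \<sigma> (\<epsilon> (inv\<^bsub>G\<^esub> \<sigma>) \<otimes>\<^bsub>A\<^esub> a) = \<theta> \<sigma> a"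
  using assms by (simp add: mult comp_inv unit_left)

lemma unit_idem: "\<sigma> \<in> carrier G \<Longrightarrow> \<epsilon> \<sigma> \<otimes>\<^bsub>A\<^esub> \<epsilon> \<sigma> = \<epsilon> \<sigma>"
  by (rule unit_left) auto

lemma bij:
  assumes "\<sigma> \<in> carrier G"
  shows "bij_betw (\<theta> \<sigma>) (\<epsilon> (inv\<^bsub>G\<^esub> \<sigma>) <#\<^bsub>A\<^esub> carrier A) (\<epsilon> \<sigma> <#\<^bsub>A\<^esub> carrier A)"
proof -
  have idem: "\<epsilon> \<tau> \<otimes>\<^bsub>A\<^esub> (\<epsilon> \<tau> \<otimes>\<^bsub>A\<^esub> a) = \<epsilon> \<tau> \<otimes>\<^bsub>A\<^esub> a" if "\<tau> \<in> carrier G" "a \<in> carrier A" for \<tau> a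
    using that by (simp add: A.m_assoc[symmetric] unit_idem)
  \<comment> \<open>Shown for every \<open>\<tau>\<close>, so that \<open>\<sigma>\<close> and its
    inverse supply the two directions of the bijection. Left multiplication by an idempotent is the
    identity on its right ideal, which turns \<open>comp_inv\<close> into genuine inversion.\<close>
  have inverse: "\<theta> (inv\<^bsub>G\<^esub> \<tau>) (\<theta> \<tau> x) = x" "\<theta> \<tau> x \<in> \<epsilon> \<tau> <#\<^bsub>A\<^esub> carrier A"
    if \<tau>: "\<tau> \<in> carrier G" and x: "x \<in> \<epsilon> (inv\<^bsub>G\<^esub> \<tau>) <#\<^bsub>A\<^esub> carrier A" for \<tau> x
  proof -
    obtain a where a: "a \<in> carrier A" "x = \<epsilon> (inv\<^bsub>G\<^esub> \<tau>) \<otimes>\<^bsub>A\<^esub> a"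
      using x by (auto simp: l_coset_def)
    have "\<theta> (inv\<^bsub>G\<^esub> \<tau>) (\<theta> \<tau> x) = \<epsilon> (inv\<^bsub>G\<^esub> \<tau>) \<otimes>\<^bsub>A\<^esub> x"
      using comp_inv[of "inv\<^bsub>G\<^esub> \<tau>" x] a \<tau> by simp
    then show "\<theta> (inv\<^bsub>G\<^esub> \<tau>) (\<theta> \<tau> x) = x" using a \<tau> by (simp add: idem)
    have "\<theta> \<tau> x = \<epsilon> \<tau> \<otimes>\<^bsub>A\<^esub> \<theta> \<tau> x" "\<theta> \<tau> x \<in> carrier A" using a \<tau> by (simp_all add: unit_left)
    then show "\<theta> \<tau> x \<in> \<epsilon> \<tau> <#\<^bsub>A\<^esub> carrier A" by (auto simp: l_coset_def)
  qed
  show ?thesis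
    using assms inverse[of \<sigma>] inverse[of "inv\<^bsub>G\<^esub> \<sigma>"]
    by (intro bij_betw_byWitness[where f' = "\<theta> (inv\<^bsub>G\<^esub> \<sigma>)"]) auto
qed

text \<open>The restrictions give the data the extensional form required in
  \<open>partial_group_actions\<close>.\<close>

lemma partial_group_action:
  defines "I \<equiv> \<lambda>\<sigma>. \<epsilon> (inv\<^bsub>G\<^esub> \<sigma>) <#\<^bsub>A\<^esub> carrier A"
  shows "partial_group_action k G A (restrict \<epsilon> (carrier G))
    (\<lambda>\<sigma>\<in>carrier G. restrict (\<theta> \<sigma>) (I \<sigma>))"
proof -
  define e where "e = restrict \<epsilon> (carrier G)"
  define \<alpha> where "\<alpha> = (\<lambda>\<sigma>\<in>carrier G. restrict (\<theta> \<sigma>) (I \<sigma>))"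
  have e [simp]: "e \<sigma> = \<epsilon> \<sigma>" if "\<sigma> \<in> carrier G" for \<sigma> using that by (simp add: e_def)
  have I_sub: "I \<sigma> \<subseteq> carrier A" if "\<sigma> \<in> carrier G" for \<sigma>
    using that by (auto simp: I_def l_coset_def)
  have I_mem: "\<epsilon> (inv\<^bsub>G\<^esub> \<sigma>) \<otimes>\<^bsub>A\<^esub> a \<in> I \<sigma>" if "a \<in> carrier A" for \<sigma> a
    using that by (auto simp: I_def l_coset_def)
  have \<alpha>: "\<alpha> \<sigma> x = \<theta> \<sigma> x" if "\<sigma> \<in> carrier G" "x \<in> I \<sigma>" for \<sigma> x
    using that by (simp add: \<alpha>_def)
  \<comment> \<open>On elements of this form \<open>\<alpha>\<close> agrees with
    \<open>\<theta>\<close> by \<open>act_unit\<close>, so the axioms on units, composition,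
    products and idempotents become facts about \<open>\<theta>\<close>.\<close>
  have val [simp]: "\<alpha> \<sigma> (\<epsilon> (inv\<^bsub>G\<^esub> \<sigma>) \<otimes>\<^bsub>A\<^esub> a) = \<theta> \<sigma> a"
    if "\<sigma> \<in> carrier G" "a \<in> carrier A" for \<sigma> a
    using that I_mem by (simp add: \<alpha> act_unit)
  have "partial_group_action k G A e \<alpha>"
  proof (intro partial_group_action.intro partial_group_action_axioms.intro)
    show "group G" "assoc_algebra k A" by unfold_locales
    show "e \<one>\<^bsub>G\<^esub> = \<one>\<^bsub>A\<^esub>" by (simp add: one)
    show "\<alpha> \<one>\<^bsub>G\<^esub> a = a" if "a \<in> carrier A" for a
      using val[of "\<one>\<^bsub>G\<^esub>" a] that by (simp add: one)
    fix \<sigma> assume \<sigma>: "\<sigma> \<in> carrier G"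
    show "e \<sigma> \<in> carrier A" "e \<sigma> \<otimes>\<^bsub>A\<^esub> e \<sigma> = e \<sigma>" using \<sigma> by (simp_all add: unit_idem)
    let ?M = "right_ideal_module A (e (inv\<^bsub>G\<^esub> \<sigma>))" and ?N = "right_ideal_module A (e \<sigma>)"
    have eM: "carrier ?M = I \<sigma>" and eN: "carrier ?N = \<epsilon> \<sigma> <#\<^bsub>A\<^esub> carrier A"
      using \<sigma> by (simp_all add: I_def)
    \<comment> \<open>\<open>right_ideal_module\<close> changes only the carrier, so the operations
      are those of \<open>A\<close>. Passing from \<open>\<alpha> \<sigma>\<close> to
      \<open>\<theta> \<sigma>\<close> at a sum or a multiple requires that it lie in
      \<open>I \<sigma>\<close>.\<close>
    have add: "x \<oplus>\<^bsub>A\<^esub> y \<in> I \<sigma>" if xy: "x \<in> I \<sigma>" "y \<in> I \<sigma>" for x y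
    proof -
      obtain a c where "a \<in> carrier A" "c \<in> carrier A"
        "x = \<epsilon> (inv\<^bsub>G\<^esub> \<sigma>) \<otimes>\<^bsub>A\<^esub> a" "y = \<epsilon> (inv\<^bsub>G\<^esub> \<sigma>) \<otimes>\<^bsub>A\<^esub> c"
        using xy by (auto simp: I_def l_coset_def)
      then show ?thesis using I_mem[of "a \<oplus>\<^bsub>A\<^esub> c" \<sigma>] \<sigma> by (simp add: A.r_distr)
    qed
    have smult: "c \<odot>\<^bsub>A\<^esub> x \<in> I \<sigma>" if c: "c \<in> carrier k" and x: "x \<in> I \<sigma>" for c x
    proof -
      obtain a where "a \<in> carrier A" "x = \<epsilon> (inv\<^bsub>G\<^esub> \<sigma>) \<otimes>\<^bsub>A\<^esub> a"
        using x by (auto simp: I_def l_coset_def)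
      then show ?thesis using I_mem[of "c \<odot>\<^bsub>A\<^esub> a" \<sigma>] \<sigma> c by (simp add: A.smult_mult_right)
    qed
    have bij: "bij_betw (\<alpha> \<sigma>) (I \<sigma>) (\<epsilon> \<sigma> <#\<^bsub>A\<^esub> carrier A)"
      using bij[OF \<sigma>] bij_betw_cong[of "I \<sigma>" "\<alpha> \<sigma>" "\<theta> \<sigma>", OF \<alpha>[OF \<sigma>]] by (simp add: I_def)
    have "\<alpha> \<sigma> \<in> mod_hom k ?M ?N"
    proof (rule mod_homI, unfold eM eN)
      fix x assume x: "x \<in> I \<sigma>"
      then have xA: "x \<in> carrier A" using I_sub[OF \<sigma>] by blast
      show "\<alpha> \<sigma> x \<in> \<epsilon> \<sigma> <#\<^bsub>A\<^esub> carrier A" using bij x by (auto simp: bij_betw_def)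
      show "\<alpha> \<sigma> (c \<odot>\<^bsub>?M\<^esub> x) = c \<odot>\<^bsub>?N\<^esub> \<alpha> \<sigma> x" if "c \<in> carrier k" for c
        using that x xA smult[OF that x] mod_homD(3)[OF hom[OF \<sigma>]] by (simp add: \<alpha> \<sigma>)
      fix y assume y: "y \<in> I \<sigma>"
      then have yA: "y \<in> carrier A" using I_sub[OF \<sigma>] by blast
      show "\<alpha> \<sigma> (x \<oplus>\<^bsub>?M\<^esub> y) = \<alpha> \<sigma> x \<oplus>\<^bsub>?N\<^esub> \<alpha> \<sigma> y"
        using x y xA yA add[OF x y] mod_homD(2)[OF hom[OF \<sigma>]] by (simp add: \<alpha> \<sigma>)
    qed
    then show "\<alpha> \<sigma> \<in> mod_iso k ?M ?N"
      unfolding mod_iso_def using bij eM eN by simp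
    \<comment> \<open>The idempotent is its own product with the unit, which is the shape that
      \<open>val\<close> expects.\<close>
    show "\<alpha> \<sigma> (e (inv\<^bsub>G\<^esub> \<sigma>)) = e \<sigma>"
      using \<sigma> val[of \<sigma> "\<one>\<^bsub>A\<^esub>"] by (simp del: val)
    fix a assume a: "a \<in> carrier A"
    show "\<alpha> \<sigma> (e (inv\<^bsub>G\<^esub> \<sigma>) \<otimes>\<^bsub>A\<^esub> a \<otimes>\<^bsub>A\<^esub> c) = \<alpha> \<sigma> (e (inv\<^bsub>G\<^esub> \<sigma>) \<otimes>\<^bsub>A\<^esub> a) \<otimes>\<^bsub>A\<^esub> \<alpha> \<sigma> (e (inv\<^bsub>G\<^esub> \<sigma>) \<otimes>\<^bsub>A\<^esub> c)"
      if c: "c \<in> carrier A" for c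
      using \<sigma> a c by (simp add: A.m_assoc mult)
    fix \<tau> assume \<tau>: "\<tau> \<in> carrier G"
    \<comment> \<open>With the idempotent written as that of the inverse of the product,
      \<open>val\<close> applies and the two sides are those of \<open>comp\<close>.\<close>
    have "inv\<^bsub>G\<^esub> \<tau> \<otimes>\<^bsub>G\<^esub> inv\<^bsub>G\<^esub> \<sigma> = inv\<^bsub>G\<^esub> (\<sigma> \<otimes>\<^bsub>G\<^esub> \<tau>)" using \<sigma> \<tau> by (simp add: G.inv_mult_group)
    then show "e \<sigma> \<otimes>\<^bsub>A\<^esub> \<alpha> (\<sigma> \<otimes>\<^bsub>G\<^esub> \<tau>) (e (inv\<^bsub>G\<^esub> \<tau> \<otimes>\<^bsub>G\<^esub> inv\<^bsub>G\<^esub> \<sigma>) \<otimes>\<^bsub>A\<^esub> a) =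
        \<alpha> \<sigma> (e (inv\<^bsub>G\<^esub> \<sigma>) \<otimes>\<^bsub>A\<^esub> \<alpha> \<tau> (e (inv\<^bsub>G\<^esub> \<tau>) \<otimes>\<^bsub>A\<^esub> a))"
      using \<sigma> \<tau> a comp[of \<sigma> \<tau> a] by simp
  qed
  then show ?thesis by (simp only: e_def \<alpha>_def)
qed

end

section \<open>From partial group actions to actions by endomorphisms\<close>

lemma partial_group_action_endo:
  assumes "partial_group_action k G A e \<alpha>"
  shows "partial_endo_action k G A (\<lambda>\<sigma> a. \<alpha> \<sigma> (e (inv\<^bsub>G\<^esub> \<sigma>) \<otimes>\<^bsub>A\<^esub> a))"
proof -
  interpret P: partial_group_action k G A e \<alpha> by fact
  have inv_closed: "e (inv\<^bsub>G\<^esub> \<sigma>) \<in> carrier A" if "\<sigma> \<in> carrier G" for \<sigma>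
    using that by (simp add: P.e_closed)
  have mem: "e \<sigma> \<otimes>\<^bsub>A\<^esub> a \<in> e \<sigma> <#\<^bsub>A\<^esub> carrier A" if "a \<in> carrier A" for \<sigma> a
    using that by (auto simp: l_coset_def)
  have hom: "\<alpha> \<sigma> \<in> mod_hom k (right_ideal_module A (e (inv\<^bsub>G\<^esub> \<sigma>))) (right_ideal_module A (e \<sigma>))"
    if "\<sigma> \<in> carrier G" for \<sigma>
    using P.alpha_iso[OF that] by (simp add: mod_iso_def)
  note D = mod_homD[OF hom, simplified]
  have ideal: "e \<sigma> <#\<^bsub>A\<^esub> carrier A \<subseteq> carrier A" if "\<sigma> \<in> carrier G" for \<sigma>
    using that P.e_closed by (auto simp: l_coset_def)
  have closed: "\<alpha> \<sigma> (e (inv\<^bsub>G\<^esub> \<sigma>) \<otimes>\<^bsub>A\<^esub> a) \<in> carrier A" if "\<sigma> \<in> carrier G" "a \<in> carrier A" for \<sigma> a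
    using D(1)[OF that(1) mem[OF that(2)]] ideal[OF that(1)] by blast
  \<comment> \<open>The unit as second factor in \<open>alpha_mult\<close>, with
    \<open>alpha_e\<close> evaluating the last term. The idempotent stands on the right, and it need
    not be central.\<close>
  have unit_right: "\<alpha> \<sigma> (e (inv\<^bsub>G\<^esub> \<sigma>) \<otimes>\<^bsub>A\<^esub> a) \<otimes>\<^bsub>A\<^esub> e \<sigma> = \<alpha> \<sigma> (e (inv\<^bsub>G\<^esub> \<sigma>) \<otimes>\<^bsub>A\<^esub> a)"
    if "\<sigma> \<in> carrier G" "a \<in> carrier A" for \<sigma> a
    using P.alpha_mult[OF that P.A.one_closed] that inv_closed by (simp add: P.alpha_e)
  show ?thesis
  proof (intro partial_endo_action.intro partial_endo_action_axioms.intro)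
    show "group G" "assoc_algebra k A" by unfold_locales
    show "\<alpha> \<one>\<^bsub>G\<^esub> (e (inv\<^bsub>G\<^esub> \<one>\<^bsub>G\<^esub>) \<otimes>\<^bsub>A\<^esub> a) = a" if "a \<in> carrier A" for a
      using that by (simp add: P.e_one P.alpha_one)
    fix \<sigma> assume \<sigma>: "\<sigma> \<in> carrier G"
    show "(\<lambda>a. \<alpha> \<sigma> (e (inv\<^bsub>G\<^esub> \<sigma>) \<otimes>\<^bsub>A\<^esub> a)) \<in> mod_hom k A A"
      using closed[OF \<sigma>] D(2,3)[OF \<sigma>] mem inv_closed[OF \<sigma>]
      by (intro mod_homI) (simp_all add: P.A.r_distr P.A.smult_mult_right)
    fix a c assume a: "a \<in> carrier A" and c: "c \<in> carrier A"
    \<comment> \<open>The second factor is left arbitrary because the rule is used again below with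
      \<open>?c\<close> in its place.\<close>
    show mult: "\<alpha> \<sigma> (e (inv\<^bsub>G\<^esub> \<sigma>) \<otimes>\<^bsub>A\<^esub> (a \<otimes>\<^bsub>A\<^esub> c)) =
        \<alpha> \<sigma> (e (inv\<^bsub>G\<^esub> \<sigma>) \<otimes>\<^bsub>A\<^esub> a) \<otimes>\<^bsub>A\<^esub> \<alpha> \<sigma> (e (inv\<^bsub>G\<^esub> \<sigma>) \<otimes>\<^bsub>A\<^esub> c)"
      if "c \<in> carrier A" for c
      using P.alpha_mult[OF \<sigma> a that] a that inv_closed[OF \<sigma>] by (simp add: P.A.m_assoc)
    fix \<tau> assume \<tau>: "\<tau> \<in> carrier G"
    let ?c = "\<alpha> \<tau> (e (inv\<^bsub>G\<^esub> \<tau>) \<otimes>\<^bsub>A\<^esub> c)" and ?d = "\<alpha> (\<sigma> \<otimes>\<^bsub>G\<^esub> \<tau>) (e (inv\<^bsub>G\<^esub> (\<sigma> \<otimes>\<^bsub>G\<^esub> \<tau>)) \<otimes>\<^bsub>A\<^esub> c)"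
    have d: "?d \<in> carrier A" using \<sigma> \<tau> c by (intro closed) auto
    have "\<alpha> \<sigma> (e (inv\<^bsub>G\<^esub> \<sigma>) \<otimes>\<^bsub>A\<^esub> (a \<otimes>\<^bsub>A\<^esub> ?c)) = \<alpha> \<sigma> (e (inv\<^bsub>G\<^esub> \<sigma>) \<otimes>\<^bsub>A\<^esub> a) \<otimes>\<^bsub>A\<^esub> \<alpha> \<sigma> (e (inv\<^bsub>G\<^esub> \<sigma>) \<otimes>\<^bsub>A\<^esub> ?c)"
      by (rule mult[OF closed[OF \<tau> c]])
    also have "\<dots> = \<alpha> \<sigma> (e (inv\<^bsub>G\<^esub> \<sigma>) \<otimes>\<^bsub>A\<^esub> a) \<otimes>\<^bsub>A\<^esub> (e \<sigma> \<otimes>\<^bsub>A\<^esub> ?d)"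
      using P.alpha_comp[OF \<sigma> \<tau> c] \<sigma> \<tau> by (simp add: P.inv_mult_group)
    \<comment> \<open>The factor \<open>e \<sigma>\<close> that \<open>alpha_comp\<close> leaves in
      the middle is absorbed by \<open>unit_right\<close>.\<close>
    also have "\<dots> = \<alpha> \<sigma> (e (inv\<^bsub>G\<^esub> \<sigma>) \<otimes>\<^bsub>A\<^esub> a) \<otimes>\<^bsub>A\<^esub> ?d"
      using closed[OF \<sigma> a] d P.e_closed[OF \<sigma>] unit_right[OF \<sigma> a]
      by (simp add: P.A.m_assoc[symmetric])
    finally show "\<alpha> \<sigma> (e (inv\<^bsub>G\<^esub> \<sigma>) \<otimes>\<^bsub>A\<^esub> (a \<otimes>\<^bsub>A\<^esub> ?c)) = \<alpha> \<sigma> (e (inv\<^bsub>G\<^esub> \<sigma>) \<otimes>\<^bsub>A\<^esub> a) \<otimes>\<^bsub>A\<^esub> ?d" .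
  qed
qed

section \<open>Partial actions of the group algebra\<close>

context cring_group
begin

text \<open>
  Both axioms of a partial \<open>kG\<close>-action are multilinear in the elements of \<open>kG\<close>, so they need only be
  tested on the grouplike basis elements.
\<close>

lemma partial_module_algebra_iff_endo:
  fixes A :: "('k, 'a, 't) module_scheme"
  assumes A: "assoc_algebra k A" and \<kappa>: "\<kappa> \<in> mod_hom k (tensor_product k H A) A"
  shows "partial_module_algebra k H A \<kappa> \<longleftrightarrow>
    partial_endo_action k G A (\<lambda>\<sigma> a. \<kappa> (pure_tensor k H A (b \<sigma>) a))"
proof -
  interpret A: assoc_algebra k A by fact
  have A_module: "module k A" ..
  define \<beta> where "\<beta> h a = \<kappa> (pure_tensor k H A h a)" for h a
  have \<beta>: "\<beta> \<in> bilin k H A A"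
    using mod_hom_bilin[OF pure_tensor_bilin[OF H_module A_module] \<kappa>] unfolding \<beta>_def .
  note left = bilin_left[OF \<beta>] and right = bilin_right[OF \<beta>]
  have \<beta>_closed [simp]: "\<beta> h a \<in> carrier A" if "h \<in> carrier F" "a \<in> carrier A" for h a
    using bilin_closed[OF \<beta>] that by simp
  note A_mult = assoc_algebra_mult_bilin[OF A]
  have L: "(\<lambda>h1 h2. \<beta> h1 a \<otimes>\<^bsub>A\<^esub> \<beta> h2 c) \<in> bilin k H H A"
    if "a \<in> carrier A" "c \<in> carrier A" for a c
    by (rule bilin_compose[OF left[OF that(1)] left[OF that(2)] A_mult])
  have R: "(\<lambda>h1 h2. \<beta> h1 a \<otimes>\<^bsub>A\<^esub> \<beta> (h2 \<otimes>\<^bsub>H\<^esub> g) c) \<in> bilin k H H A"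
    if "g \<in> carrier H" "a \<in> carrier A" "c \<in> carrier A" for a c g
    by (rule bilin_compose[OF left[OF that(2)]
        mod_hom_compose[OF bilin_left[OF H_mult_bilin that(1)] left[OF that(3)]] A_mult])
  \<comment> \<open>The second action axiom has two variables in the group algebra, so its right
    side must be bilinear in \<open>h\<close> and \<open>g\<close> before it can be tested on pairs
    of group elements.\<close>
  have R': "(\<lambda>h g. sweedler k H A (\<lambda>h1 h2. \<beta> h1 a \<otimes>\<^bsub>A\<^esub> \<beta> (h2 \<otimes>\<^bsub>H\<^esub> g) c) h) \<in> bilin k H H A"
    if "a \<in> carrier A" "c \<in> carrier A" for a c
    by (rule sweedler_bilin[OF A_module H_module R[OF _ that]], assumption,
        rule mod_hom_compose[OF mod_hom_compose[OF bilin_right[OF H_mult_bilin] left[OF that(2)]]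
          bilin_right[OF A_mult]]) (use that in auto)
  have basis: "b \<sigma> \<in> carrier H" if "\<sigma> \<in> carrier G" for \<sigma> using that by simp
  show ?thesis unfolding \<beta>_def[symmetric]
  proof
    assume "partial_module_algebra k H A \<kappa>"
    then interpret P: partial_module_algebra k H A \<kappa> "\<lambda>h a. \<kappa> (pure_tensor k H A h a)" .
    note act_mult = P.act_mult[folded \<beta>_def] and act_mult_act = P.act_mult_act[folded \<beta>_def]
      and act_one = P.act_one[folded \<beta>_def]
    show "partial_endo_action k G A (\<lambda>\<sigma>. \<beta> (b \<sigma>))"
    proof (intro partial_endo_action.intro partial_endo_action_axioms.intro)
      show "group G" by unfold_locales
      show "assoc_algebra k A" by fact
      show "\<beta> (b \<one>\<^bsub>G\<^esub>) a = a" if "a \<in> carrier A" for a using act_one[OF that] by simp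
      fix \<sigma> assume \<sigma>: "\<sigma> \<in> carrier G"
      show "\<beta> (b \<sigma>) \<in> mod_hom k A A" using \<sigma> by (intro right) auto
      fix a c assume ac: "a \<in> carrier A" "c \<in> carrier A"
      show "\<beta> (b \<sigma>) (a \<otimes>\<^bsub>A\<^esub> c) = \<beta> (b \<sigma>) a \<otimes>\<^bsub>A\<^esub> \<beta> (b \<sigma>) c"
        using act_mult[OF basis[OF \<sigma>] ac] sweedler_basis[OF A_module L[OF ac] \<sigma>] by simp
      fix \<tau> assume \<tau>: "\<tau> \<in> carrier G"
      show "\<beta> (b \<sigma>) (a \<otimes>\<^bsub>A\<^esub> \<beta> (b \<tau>) c) = \<beta> (b \<sigma>) a \<otimes>\<^bsub>A\<^esub> \<beta> (b (\<sigma> \<otimes>\<^bsub>G\<^esub> \<tau>)) c"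
        using act_mult_act[OF basis[OF \<sigma>] basis[OF \<tau>] ac] \<sigma> \<tau>
          sweedler_basis[OF A_module R[OF basis[OF \<tau>] ac] \<sigma>] by (simp add: H_mult_basis)
    qed
  next
    assume "partial_endo_action k G A (\<lambda>\<sigma>. \<beta> (b \<sigma>))"
    then interpret P: partial_endo_action k G A "\<lambda>\<sigma>. \<beta> (b \<sigma>)" .
    show "partial_module_algebra k H A \<kappa>"
    proof (intro partial_module_algebra.intro partial_module_algebra_axioms.intro, fold \<beta>_def)
      show "bialgebra k H" by (rule group_algebra_bialgebra)
      show "assoc_algebra k A" by fact
      show "\<kappa> \<in> mod_hom k (tensor_product k H A) A" by fact
      show "\<beta> \<one>\<^bsub>H\<^esub> a = a" if "a \<in> carrier A" for a using P.one[OF that] by simp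
      fix h a c assume h: "h \<in> carrier H" and ac: "a \<in> carrier A" "c \<in> carrier A"
      have prod: "a \<otimes>\<^bsub>A\<^esub> c \<in> carrier A" using ac by simp
      show "\<beta> h (a \<otimes>\<^bsub>A\<^esub> c) = sweedler k H A (\<lambda>h1 h2. \<beta> h1 a \<otimes>\<^bsub>A\<^esub> \<beta> h2 c) h"
        by (rule H_hom_eq[OF A_module left[OF prod] sweedler_hom[OF A_module L[OF ac]] _ h])
          (use ac in \<open>simp add: sweedler_basis[OF A_module L[OF ac]] P.mult\<close>)
      fix g assume g: "g \<in> carrier H"
      have "(\<lambda>h g. \<beta> h (a \<otimes>\<^bsub>A\<^esub> \<beta> g c)) \<in> bilin k H H A"
        by (rule bilin_compose[OF mod_hom_id
            mod_hom_compose[OF left[OF ac(2)] bilin_right[OF A_mult ac(1)]] \<beta>])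
      then show "\<beta> h (a \<otimes>\<^bsub>A\<^esub> \<beta> g c) =
          sweedler k H A (\<lambda>h1 h2. \<beta> h1 a \<otimes>\<^bsub>A\<^esub> \<beta> (h2 \<otimes>\<^bsub>H\<^esub> g) c) h"
        by (rule H_bilin_eq[OF A_module _ R'[OF ac] _ h g])
          (use ac in \<open>simp add: sweedler_basis[OF A_module R[OF basis ac]] P.mult_act H_mult_basis\<close>)
    qed
  qed
qed

text \<open>For linear \<open>\<theta> \<sigma>\<close> this is the linear map sending the tensor of
  \<open>\<sigma>\<close> and \<open>a\<close> to \<open>\<theta> \<sigma> a\<close>. It is cut down
  to the carrier to be extensional, as members of \<open>partial_bialgebra_actions\<close> must
  be.\<close>

definition kappa_of :: "('k, 'a, 't) module_scheme \<Rightarrow> ('g \<Rightarrow> 'a \<Rightarrow> 'a) \<Rightarrow>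
    (('g \<Rightarrow> 'k) \<times> 'a \<Rightarrow> 'k) set \<Rightarrow> 'a"
  where "kappa_of A \<theta> = restrict (tensor_lift k A (\<lambda>h a. lin_ext k A (\<lambda>\<sigma>. \<theta> \<sigma> a) h))
    (carrier (tensor_product k H A))"

lemma kappa_of:
  fixes A :: "('k, 'a, 't) module_scheme"
  assumes A: "module k A" and \<theta>: "\<And>\<sigma>. \<sigma> \<in> carrier G \<Longrightarrow> \<theta> \<sigma> \<in> mod_hom k A A"
  shows kappa_of_hom: "kappa_of A \<theta> \<in> mod_hom k (tensor_product k H A) A"
    and kappa_of_pure: "\<And>\<sigma> a. \<lbrakk>\<sigma> \<in> carrier G; a \<in> carrier A\<rbrakk> \<Longrightarrow>
      kappa_of A \<theta> (pure_tensor k H A (b \<sigma>) a) = \<theta> \<sigma> a"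
proof -
  have bilin: "(\<lambda>h a. lin_ext k A (\<lambda>\<sigma>. \<theta> \<sigma> a) h) \<in> bilin k H A A"
    unfolding group_algebra_bilin by (rule lin_ext_bilin[OF A \<theta> A])
  show "kappa_of A \<theta> \<in> mod_hom k (tensor_product k H A) A"
    by (rule mod_hom_cong[OF tensor_product_module[OF H_module A]
        tensor_lift_hom[OF H_module A A bilin]]) (simp add: kappa_of_def)
  show "kappa_of A \<theta> (pure_tensor k H A (b \<sigma>) a) = \<theta> \<sigma> a"
    if \<sigma>: "\<sigma> \<in> carrier G" and a: "a \<in> carrier A" for \<sigma> a
  proof -
    have b: "b \<sigma> \<in> carrier H" using \<sigma> by simp
    have "pure_tensor k H A (b \<sigma>) a \<in> carrier (tensor_product k H A)"
      by (rule bilin_closed[OF pure_tensor_bilin[OF H_module A] b a])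
    then show ?thesis
      by (simp add: kappa_of_def tensor_lift_pure[OF H_module A A bilin b a]
          lin_ext_basis_vec[OF A] mod_homD(1)[OF \<theta>[OF \<sigma>] a])
  qed
qed

text \<open>A linear map on the tensor product is fixed by its values on pure tensors, and for given
  \<open>a\<close> the first factor may be taken from the basis; extensionality fixes the values off
  the carrier.\<close>

lemma kappa_eqI:
  fixes A :: "('k, 'a, 't) module_scheme"
  assumes A: "module k A"
    and \<kappa>: "\<kappa> \<in> mod_hom k (tensor_product k H A) A" "\<kappa> \<in> extensional (carrier (tensor_product k H A))"
    and \<kappa>': "\<kappa>' \<in> mod_hom k (tensor_product k H A) A" "\<kappa>' \<in> extensional (carrier (tensor_product k H A))"
    and eq: "\<And>\<sigma> a. \<lbrakk>\<sigma> \<in> carrier G; a \<in> carrier A\<rbrakk> \<Longrightarrow>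
      \<kappa> (pure_tensor k H A (b \<sigma>) a) = \<kappa>' (pure_tensor k H A (b \<sigma>) a)"
  shows "\<kappa> = \<kappa>'"
proof (rule extensionalityI[OF \<kappa>(2) \<kappa>'(2)])
  note pure = pure_tensor_bilin[OF H_module A]
  have "\<kappa> (pure_tensor k H A h a) = \<kappa>' (pure_tensor k H A h a)"
    if "h \<in> carrier H" "a \<in> carrier A" for h a
    by (rule H_hom_eq[OF A mod_hom_compose[OF bilin_left[OF pure that(2)] \<kappa>(1)]
        mod_hom_compose[OF bilin_left[OF pure that(2)] \<kappa>'(1)] _ that(1)]) (rule eq[OF _ that(2)])
  then show "\<kappa> t = \<kappa>' t" if "t \<in> carrier (tensor_product k H A)" for t
    by (rule tensor_hom_eq[OF H_module A A \<kappa>(1) \<kappa>'(1) _ that])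
qed

section \<open>The bijection and its inverse\<close>

lemma partial_action_bij:
  fixes A :: "('k, 'a, 't) module_scheme"
  assumes "assoc_algebra k A"
  defines "\<Phi> \<equiv> \<lambda>(e, \<alpha>). kappa_of A (\<lambda>\<sigma> a. \<alpha> \<sigma> (e (inv\<^bsub>G\<^esub> \<sigma>) \<otimes>\<^bsub>A\<^esub> a))"
  shows "bij_betw \<Phi> (partial_group_actions k G A) (partial_bialgebra_actions k H A)"
    and "(e, \<alpha>) \<in> partial_group_actions k G A \<Longrightarrow> \<sigma> \<in> carrier G \<Longrightarrow> a \<in> carrier A \<Longrightarrow>
      \<Phi> (e, \<alpha>) (pure_tensor k H A (b \<sigma>) a) = \<alpha> \<sigma> (e (inv\<^bsub>G\<^esub> \<sigma>) \<otimes>\<^bsub>A\<^esub> a)"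
proof -
  interpret A: assoc_algebra k A by fact
  have A: "module k A" ..
  let ?T = "tensor_product k H A"
  define \<theta> where "\<theta> \<kappa> \<sigma> a = \<kappa> (pure_tensor k H A (b \<sigma>) a)" for \<kappa> :: "(('g \<Rightarrow> 'k) \<times> 'a \<Rightarrow> 'k) set \<Rightarrow> 'a" and \<sigma> a
  \<comment> \<open>The candidate inverse, with the components that
    \<open>partial_endo_action.partial_group_action\<close> produces from
    \<open>\<theta> \<kappa>\<close>.\<close>
  define \<Psi> where "\<Psi> \<kappa> = (\<lambda>\<sigma>\<in>carrier G. \<theta> \<kappa> \<sigma> \<one>\<^bsub>A\<^esub>,
    \<lambda>\<sigma>\<in>carrier G. restrict (\<theta> \<kappa> \<sigma>) (\<theta> \<kappa> (inv\<^bsub>G\<^esub> \<sigma>) \<one>\<^bsub>A\<^esub> <#\<^bsub>A\<^esub> carrier A))" for \<kappa>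
  \<comment> \<open>\<open>\<theta> \<kappa>\<close> sees only pure tensors with a group element in
    front, so extensionality and linearity of \<open>\<kappa>\<close> stand as separate
    conditions.\<close>
  have \<kappa>_iff: "\<kappa> \<in> partial_bialgebra_actions k H A \<longleftrightarrow> \<kappa> \<in> extensional (carrier ?T) \<and>
      \<kappa> \<in> mod_hom k ?T A \<and> partial_endo_action k G A (\<theta> \<kappa>)" for \<kappa>
    using partial_module_algebra_iff_endo[OF A.assoc_algebra_axioms, of \<kappa>]
      partial_module_algebra.hom[of k H A \<kappa>]
    unfolding partial_bialgebra_actions_def \<theta>_def by blast
  have endo: "partial_endo_action k G A (\<lambda>\<sigma> a. \<alpha> \<sigma> (e (inv\<^bsub>G\<^esub> \<sigma>) \<otimes>\<^bsub>A\<^esub> a))"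
    if "(e, \<alpha>) \<in> partial_group_actions k G A" for e \<alpha>
    using that by (auto simp: partial_group_actions_def intro: partial_group_action_endo)
  have \<Phi>_hom: "\<Phi> (e, \<alpha>) \<in> mod_hom k ?T A" and
    \<Phi>_pure: "\<lbrakk>\<sigma> \<in> carrier G; a \<in> carrier A\<rbrakk> \<Longrightarrow> \<theta> (\<Phi> (e, \<alpha>)) \<sigma> a = \<alpha> \<sigma> (e (inv\<^bsub>G\<^esub> \<sigma>) \<otimes>\<^bsub>A\<^esub> a)"
    if "(e, \<alpha>) \<in> partial_group_actions k G A" for e \<alpha> \<sigma> a
    using kappa_of[OF A partial_endo_action.hom[OF endo[OF that]]] by (auto simp: \<Phi>_def \<theta>_def)
  show "(e, \<alpha>) \<in> partial_group_actions k G A \<Longrightarrow> \<sigma> \<in> carrier G \<Longrightarrow> a \<in> carrier A \<Longrightarrow>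
      \<Phi> (e, \<alpha>) (pure_tensor k H A (b \<sigma>) a) = \<alpha> \<sigma> (e (inv\<^bsub>G\<^esub> \<sigma>) \<otimes>\<^bsub>A\<^esub> a)"
    using \<Phi>_pure by (simp add: \<theta>_def)
  have \<Phi>_ext: "\<Phi> p \<in> extensional (carrier ?T)" for p
    by (cases p) (simp add: \<Phi>_def kappa_of_def)
  have \<Phi>_mem: "\<Phi> (e, \<alpha>) \<in> partial_bialgebra_actions k H A" if "(e, \<alpha>) \<in> partial_group_actions k G A" for e \<alpha>
  proof -
    interpret P: partial_endo_action k G A "\<lambda>\<sigma> a. \<alpha> \<sigma> (e (inv\<^bsub>G\<^esub> \<sigma>) \<otimes>\<^bsub>A\<^esub> a)" by (rule endo[OF that])
    \<comment> \<open>Agreement with the family of \<open>endo\<close> is known only on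
      \<open>carrier A\<close>, so the axioms are transferred one at a time.\<close>
    have "partial_endo_action k G A (\<theta> (\<Phi> (e, \<alpha>)))"
    proof (intro partial_endo_action.intro partial_endo_action_axioms.intro)
      show "group G" "assoc_algebra k A" by unfold_locales
      show "\<theta> (\<Phi> (e, \<alpha>)) \<sigma> \<in> mod_hom k A A" if "\<sigma> \<in> carrier G" for \<sigma>
        by (rule mod_hom_cong[OF A P.hom[OF that]]) (simp add: \<Phi>_pure[OF \<open>_ \<in> partial_group_actions k G A\<close> that])
    qed (use P.mult P.mult_act P.one P.closed in \<open>simp_all add: \<Phi>_pure[OF that]\<close>)
    then show ?thesis by (simp add: \<kappa>_iff \<Phi>_ext \<Phi>_hom[OF that])
  qed
  have \<Psi>_mem: "\<Psi> \<kappa> \<in> partial_group_actions k G A" and \<Phi>\<Psi>: "\<Phi> (\<Psi> \<kappa>) = \<kappa>"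
    if \<kappa>: "\<kappa> \<in> partial_bialgebra_actions k H A" for \<kappa>
  proof -
    interpret P: partial_endo_action k G A "\<theta> \<kappa>" using \<kappa> by (simp add: \<kappa>_iff)
    show mem: "\<Psi> \<kappa> \<in> partial_group_actions k G A"
      using P.partial_group_action by (simp add: partial_group_actions_def \<Psi>_def)
    obtain e \<alpha> where p: "\<Psi> \<kappa> = (e, \<alpha>)" by (cases "\<Psi> \<kappa>")
    \<comment> \<open>Restricting \<open>\<theta> \<kappa> \<sigma>\<close> to the ideal loses
      nothing: multiplying by the idempotent first gives the same value, by
      \<open>act_unit\<close>.\<close>
    have "\<theta> (\<Phi> (\<Psi> \<kappa>)) \<sigma> a = \<theta> \<kappa> \<sigma> a" if \<sigma>: "\<sigma> \<in> carrier G" and a: "a \<in> carrier A" for \<sigma> a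
    proof -
      have e: "e (inv\<^bsub>G\<^esub> \<sigma>) = \<theta> \<kappa> (inv\<^bsub>G\<^esub> \<sigma>) \<one>\<^bsub>A\<^esub>"
        and \<alpha>: "\<alpha> \<sigma> = restrict (\<theta> \<kappa> \<sigma>) (\<theta> \<kappa> (inv\<^bsub>G\<^esub> \<sigma>) \<one>\<^bsub>A\<^esub> <#\<^bsub>A\<^esub> carrier A)"
        using p \<sigma> by (auto simp: \<Psi>_def)
      have "e (inv\<^bsub>G\<^esub> \<sigma>) \<otimes>\<^bsub>A\<^esub> a \<in> \<theta> \<kappa> (inv\<^bsub>G\<^esub> \<sigma>) \<one>\<^bsub>A\<^esub> <#\<^bsub>A\<^esub> carrier A"
        using a by (auto simp: e l_coset_def)
      then have "\<alpha> \<sigma> (e (inv\<^bsub>G\<^esub> \<sigma>) \<otimes>\<^bsub>A\<^esub> a) = \<theta> \<kappa> \<sigma> (e (inv\<^bsub>G\<^esub> \<sigma>) \<otimes>\<^bsub>A\<^esub> a)" by (simp add: \<alpha>)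
      also have "\<dots> = \<theta> \<kappa> \<sigma> a" using P.act_unit[OF \<sigma> a] by (simp add: e)
      finally show ?thesis using \<Phi>_pure[OF mem[unfolded p] \<sigma> a] by (simp add: p)
    qed
    then show "\<Phi> (\<Psi> \<kappa>) = \<kappa>"
      using \<kappa> \<Phi>_hom[OF mem[unfolded p]] by (intro kappa_eqI[OF A _ \<Phi>_ext]) (auto simp: \<kappa>_iff p \<theta>_def)
  qed
  have \<Psi>\<Phi>: "\<Psi> (\<Phi> (e, \<alpha>)) = (e, \<alpha>)" if mem: "(e, \<alpha>) \<in> partial_group_actions k G A" for e \<alpha>
  proof -
    interpret P: partial_group_action k G A e \<alpha> using mem by (simp add: partial_group_actions_def)
    have ext: "e \<in> extensional (carrier G)" "\<alpha> \<in> extensional (carrier G)"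
      "\<And>\<sigma>. \<sigma> \<in> carrier G \<Longrightarrow> \<alpha> \<sigma> \<in> extensional (e (inv\<^bsub>G\<^esub> \<sigma>) <#\<^bsub>A\<^esub> carrier A)"
      using mem by (auto simp: partial_group_actions_def)
    have e: "\<theta> (\<Phi> (e, \<alpha>)) \<sigma> \<one>\<^bsub>A\<^esub> = e \<sigma>" if "\<sigma> \<in> carrier G" for \<sigma>
      using that by (simp add: \<Phi>_pure[OF mem] P.alpha_e P.e_closed)
    \<comment> \<open>An element of the right ideal is fixed by left multiplication with its
      idempotent, so on the ideal the formula in \<open>\<Phi>_pure\<close> reduces to
      \<open>\<alpha> \<sigma>\<close>.\<close>
    have \<alpha>: "restrict (\<theta> (\<Phi> (e, \<alpha>)) \<sigma>) (e (inv\<^bsub>G\<^esub> \<sigma>) <#\<^bsub>A\<^esub> carrier A) = \<alpha> \<sigma>" if \<sigma>: "\<sigma> \<in> carrier G" for \<sigma>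
    proof (rule extensionalityI[OF restrict_extensional ext(3)[OF \<sigma>]])
      fix x assume x: "x \<in> e (inv\<^bsub>G\<^esub> \<sigma>) <#\<^bsub>A\<^esub> carrier A"
      then obtain a where a: "a \<in> carrier A" "x = e (inv\<^bsub>G\<^esub> \<sigma>) \<otimes>\<^bsub>A\<^esub> a" by (auto simp: l_coset_def)
      have "e (inv\<^bsub>G\<^esub> \<sigma>) \<in> carrier A" using \<sigma> by (simp add: P.e_closed)
      moreover from this have "e (inv\<^bsub>G\<^esub> \<sigma>) \<otimes>\<^bsub>A\<^esub> x = x"
        using a \<sigma> by (simp add: A.m_assoc[symmetric] P.e_idem)
      ultimately show "restrict (\<theta> (\<Phi> (e, \<alpha>)) \<sigma>) (e (inv\<^bsub>G\<^esub> \<sigma>) <#\<^bsub>A\<^esub> carrier A) x = \<alpha> \<sigma> x"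
        using x a \<sigma> by (simp add: \<Phi>_pure[OF mem])
    qed
    show ?thesis unfolding \<Psi>_def prod.inject
    proof
      show "(\<lambda>\<sigma>\<in>carrier G. \<theta> (\<Phi> (e, \<alpha>)) \<sigma> \<one>\<^bsub>A\<^esub>) = e"
        by (rule extensionalityI[OF restrict_extensional ext(1)]) (simp add: e)
      show "(\<lambda>\<sigma>\<in>carrier G. restrict (\<theta> (\<Phi> (e, \<alpha>)) \<sigma>)
          (\<theta> (\<Phi> (e, \<alpha>)) (inv\<^bsub>G\<^esub> \<sigma>) \<one>\<^bsub>A\<^esub> <#\<^bsub>A\<^esub> carrier A)) = \<alpha>"
        by (rule extensionalityI[OF restrict_extensional ext(2)]) (simp add: e \<alpha>)
    qed
  qed
  show "bij_betw \<Phi> (partial_group_actions k G A) (partial_bialgebra_actions k H A)"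
    using \<Psi>\<Phi> \<Phi>\<Psi> \<Psi>_mem \<Phi>_mem by (intro bij_betw_byWitness[where f' = \<Psi>]) auto
qed

end

text \<open>A bare bijection would only compare the sizes of the two sets. The second conjunct
  identifies it as the natural one: by \<open>kappa_eqI\<close> its values on group elements
  determine every image of \<open>\<Phi>\<close>.\<close>

theorem proposition4p9:
  fixes k :: "('k, 'r) ring_scheme" and A :: "('k, 'a, 't) module_scheme"
    and G :: "('g, 's) monoid_scheme"
  assumes "cring k" and "assoc_algebra k A" and "group G"
  shows "\<exists>\<Phi>. bij_betw \<Phi> (partial_group_actions k G A)
      (partial_bialgebra_actions k (group_algebra k G) A) \<and>
    (\<forall>(e, \<alpha>) \<in> partial_group_actions k G A. \<forall>\<sigma>\<in>carrier G. \<forall>a\<in>carrier A.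
      \<Phi> (e, \<alpha>) (pure_tensor k (group_algebra k G) A (basis_vec k \<sigma>) a) =
      \<alpha> \<sigma> (e (inv\<^bsub>G\<^esub> \<sigma>) \<otimes>\<^bsub>A\<^esub> a))"
proof -
  interpret cring_group k G using assms by (simp add: cring_group_def)
  from partial_action_bij[OF assms(2)] show ?thesis by blast
qed

end
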